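(* Let $A$ be a commutative algebra over $\mathbb{C}$, let $Y$ be a pointed simplicial finite set, let $N\geq 2$ and let $q\in\mathbb{C}$ be a primitive $N$-th root of unity. Let $D=\{D_n\}_{n\geq 0}$ be a normalized higher derivation on $A$. Then, for each $k\geq 0$, $D$ induces a morphism $$L_D^{Y,k}:{}_qHH_*^Y(A)=\bigoplus_{n=0}^{\infty}{}_qHH_n^Y(A)\longrightarrow {}_qHH_*^Y(A)=\bigoplus_{n=0}^{\infty}{}_qHH_n^Y(A)$$ on the $q$-Hochschild homology groups of $A$ of order $Y$; that is, the levelwise maps $L_{D,i}^{Y,k}:\mathcal{L}^Y(A)_i\longrightarrow\mathcal{L}^Y(A)_i$ ($i\geq 0$) defined in the context induce a well-defined linear map on the homology objects of the $N$-complex $(\mathcal{L}^Y(A),{}_qb)$.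
   Context: $Vect$ is the category of complex vector spaces; tensor products are over $\mathbb{C}$. A higher (Hasse-Schmidt) derivation on $A$ is a sequence $D=\{D_n\}_{n\geq 0}$ of $\mathbb{C}$-linear maps $D_n:A\to A$ with $D_n(aa')=\sum_{i=0}^n D_i(a)D_{n-i}(a')$ for all $n\geq 0$, $a,a'\in A$; it is normalized if $D_0=1$ (the identity map). $\Gamma$ is the category with objects $[n]=\{0,1,\dots,n\}$, $n\geq 0$, pointed at $0$, and morphisms the maps of sets preserving $0$. The functor $\mathcal{L}(A):\Gamma\to Vect$ sends $[n]$ to $A\otimes A^{\otimes n}$, and $\phi:[m]\to[n]$ to $\mathcal{L}(A)(\phi)(a_0\otimes\dots\otimes a_m)=b_0\otimes\dots\otimes b_n$ with $b_j=\prod_{\phi(i)=j}a_i$ (empty product $=1$). It is extended to the category $Fin_*$ of finite pointed sets by $\mathcal{L}(A)(T)=\mathrm{colim}_{\Gamma\ni T'\to T}\,\mathcal{L}(A)(T')$. A pointed simplicial finite set is a functor $Y:\Delta^{op}\to Fin_*$, with $\Delta$ the simplex category; $\mathcal{L}^Y(A)=\mathcal{L}(A)\circ Y:\Delta^{op}\to Vect$ is a simplicial vector space, with $i$-th component $\mathcal{L}^Y(A)_i=\mathcal{L}(A)(Y_i)$ and face maps $d_n^i:\mathcal{L}^Y(A)_n\to\mathcal{L}^Y(A)_{n-1}$, $0\leq i\leq n$. Set $\mathcal{L}^Y(A)_n=0$ for $n<0$ and ${}_qb_n=\sum_{i=0}^n q^i d_n^i:\mathcal{L}^Y(A)_n\to\mathcal{L}^Y(A)_{n-1}$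 (with ${}_qb_n=0$ for $n\le 0$). It is known that ${}_qb^N=0$, i.e. $(\mathcal{L}^Y(A),{}_qb)$ is an $N$-complex (a sequence of objects and maps of degree $-1$, any $N$ consecutive ones composing to $0$). For an $N$-complex $(C_*,b)$ the homology object is $H_{\{n\}}(C_*,b)=\bigoplus_{i=1}^{N-1}H_{\{i,n\}}(C_*,b)$, where $H_{\{i,n\}}(C_*,b)=\mathrm{Ker}(b^i:C_n\to C_{n-i})/\mathrm{Im}(b^{N-i}:C_{n+N-i}\to C_n)$. The $q$-Hochschild homology groups of $A$ of order $Y$ are ${}_qHH_n^Y(A)=H_{\{n\}}(\mathcal{L}^Y(A),{}_qb)$, $n\geq 0$. Given $D=\{D_n\}_{n\ge0}$ and $k\geq 0$, define $L_D^k([n]):\mathcal{L}(A)([n])\to\mathcal{L}(A)([n])$ by $a_0\otimes\dots\otimes a_n\mapsto\sum_{p_0+\dots+p_n=k}D_{p_0}(a_0)\otimes\dots\otimes D_{p_n}(a_n)$, the sum being over ordered tuples of non-negative integers. For $T\in Fin_*$, $L_D^k(T):\mathcal{L}(A)(T)\to\mathcal{L}(A)(T)$ is the map induced on the colimit by the maps $L_D^k(T')$, $T'\in\Gamma$; equivalently $L_D^k(T)=\mathcal{L}(A)(\sigma)\circ L_D^k([m])\circ\mathcal{L}(A)(\sigma)^{-1}$ for any pointed bijection $\sigma:[m]\to T$. Put $L_{D,i}^{Y,k}=L_D^k(Y_i):\mathcal{L}^Y(A)_i\to\mathcal{L}^Y(A)_i$. The map $L_D^{Y,k}$ on ${}_qHH_*^Y(A)$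 is the one induced by $L_{D,n}^{Y,k}$ on each summand $H_{\{i,n\}}$. *)

theory Defs
  imports Complex_Main "HOL-Algebra.Algebra" "HOL-Algebra.Algebraic_Closure_Type"
begin

section \<open>Complex vector spaces\<close>

text \<open>
  A complex vector space is a module, in the sense of \<^locale>\<open>module\<close>, over the field \<open>\<C>\<close>.
  The record fields \<open>mult\<close> and \<open>one\<close> play no role for a module; they are left
  \<open>undefined\<close> in the vector spaces constructed below.
\<close>

abbreviation complex_ring :: "complex ring" (\<open>\<C>\<close>)
  where "\<C> \<equiv> ring_of_type_algebra"

definition linear_map ::
  "(complex, 'v) module \<Rightarrow> (complex, 'w) module \<Rightarrow> ('v \<Rightarrow> 'w) \<Rightarrow> bool"
  where "linear_map M M' f \<longleftrightarrow>
    f \<in> carrier M \<rightarrow> carrier M' \<and>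
    (\<forall>x\<in>carrier M. \<forall>y\<in>carrier M. f (x \<oplus>\<^bsub>M\<^esub> y) = f x \<oplus>\<^bsub>M'\<^esub> f y) \<and>
    (\<forall>c. \<forall>x\<in>carrier M. f (c \<odot>\<^bsub>M\<^esub> x) = c \<odot>\<^bsub>M'\<^esub> f x)"

text \<open>Morphisms are extensional functions, so that equality of morphisms is equality in HOL.\<close>

definition Lin :: "(complex, 'v) module \<Rightarrow> (complex, 'w) module \<Rightarrow> ('v \<Rightarrow> 'w) set"
  where "Lin M M' = {f \<in> extensional (carrier M). linear_map M M' f}"

definition zero_space :: "(complex, 'v) module"
  where "zero_space =
    \<lparr>carrier = {undefined}, monoid.mult = undefined, one = undefined,
     ring.zero = undefined, ring.add = (\<lambda>_ _. undefined), module.smult = (\<lambda>_ _. undefined)\<rparr>"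

definition free_space :: "'x set \<Rightarrow> (complex, 'x \<Rightarrow> complex) module"
  where "free_space S =
    \<lparr>carrier = {v. finite {x. v x \<noteq> 0} \<and> {x. v x \<noteq> 0} \<subseteq> S},
     monoid.mult = undefined, one = undefined,
     ring.zero = (\<lambda>_. 0), ring.add = (\<lambda>v w x. v x + w x), module.smult = (\<lambda>c v x. c * v x)\<rparr>"

definition basis_vector :: "'x \<Rightarrow> 'x \<Rightarrow> complex"
  where "basis_vector x = (\<lambda>y. if y = x then 1 else 0)"

definition direct_sum ::
  "'i set \<Rightarrow> ('i \<Rightarrow> (complex, 'v) module) \<Rightarrow> (complex, 'i \<Rightarrow> 'v) module"
  where "direct_sum I M =
    \<lparr>carrier = {v \<in> (\<Pi>\<^sub>E i\<in>I. carrier (M i)). finite {i \<in> I. v i \<noteq> \<zero>\<^bsub>M i\<^esub>}},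
     monoid.mult = undefined, one = undefined,
     ring.zero = (\<lambda>i\<in>I. \<zero>\<^bsub>M i\<^esub>),
     ring.add = (\<lambda>v w. \<lambda>i\<in>I. v i \<oplus>\<^bsub>M i\<^esub> w i),
     module.smult = (\<lambda>c v. \<lambda>i\<in>I. c \<odot>\<^bsub>M i\<^esub> v i)\<rparr>"

definition summand_inj ::
  "'i set \<Rightarrow> ('i \<Rightarrow> (complex, 'v) module) \<Rightarrow> 'i \<Rightarrow> 'v \<Rightarrow> ('i \<Rightarrow> 'v)"
  where "summand_inj I M i x = (\<lambda>j\<in>I. if j = i then x else \<zero>\<^bsub>M j\<^esub>)"

definition subspace_span :: "(complex, 'v) module \<Rightarrow> 'v set \<Rightarrow> 'v set"
  where "subspace_span M S = \<Inter>{W. submodule W \<C> M \<and> S \<subseteq> W}"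

text \<open>The quotient by a subspace \<open>W\<close>; its elements are the cosets \<open>W +> x\<close>.\<close>

definition quotient_space ::
  "(complex, 'v) module \<Rightarrow> 'v set \<Rightarrow> (complex, 'v set) module"
  where "quotient_space M W =
    \<lparr>carrier = a_rcosets\<^bsub>M\<^esub> W, monoid.mult = undefined, one = undefined,
     ring.zero = W, ring.add = set_add M, module.smult = (\<lambda>c V. \<Union>x\<in>V. W +>\<^bsub>M\<^esub> (c \<odot>\<^bsub>M\<^esub> x))\<rparr>"


section \<open>The tensor powers of an algebra\<close>

text \<open>
  \<open>tensor_power A n\<close> is \<open>A \<otimes> A\<^sup>\<otimes>\<^sup>n\<close>, with \<open>n + 1\<close> tensor factors indexed by \<open>0, \<dots>, n\<close>:
  the free vector space on the tuples \<open>(a\<^sub>0, \<dots>, a\<^sub>n)\<close> modulo multilinearity.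
\<close>

definition tuples :: "(complex, 'a) module \<Rightarrow> nat \<Rightarrow> (nat \<Rightarrow> 'a) set"
  where "tuples A n = {0..n} \<rightarrow>\<^sub>E carrier A"

definition tensor_relations :: "(complex, 'a) module \<Rightarrow> nat \<Rightarrow> ((nat \<Rightarrow> 'a) \<Rightarrow> complex) set"
  where "tensor_relations A n =
    {basis_vector (a(i := x \<oplus>\<^bsub>A\<^esub> y)) \<ominus>\<^bsub>free_space (tuples A n)\<^esub>
       (basis_vector (a(i := x)) \<oplus>\<^bsub>free_space (tuples A n)\<^esub> basis_vector (a(i := y)))
      | a i x y. a \<in> tuples A n \<and> i \<in> {0..n} \<and> x \<in> carrier A \<and> y \<in> carrier A} \<union>
    {basis_vector (a(i := c \<odot>\<^bsub>A\<^esub> x)) \<ominus>\<^bsub>free_space (tuples A n)\<^esub>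
       (c \<odot>\<^bsub>free_space (tuples A n)\<^esub> basis_vector (a(i := x)))
      | a i c x. a \<in> tuples A n \<and> i \<in> {0..n} \<and> x \<in> carrier A}"

definition tensor_relation_space ::
  "(complex, 'a) module \<Rightarrow> nat \<Rightarrow> ((nat \<Rightarrow> 'a) \<Rightarrow> complex) set"
  where "tensor_relation_space A n =
    subspace_span (free_space (tuples A n)) (tensor_relations A n)"

definition tensor_power ::
  "(complex, 'a) module \<Rightarrow> nat \<Rightarrow> (complex, ((nat \<Rightarrow> 'a) \<Rightarrow> complex) set) module"
  where "tensor_power A n =
    quotient_space (free_space (tuples A n)) (tensor_relation_space A n)"

definition pure_tensor ::
  "(complex, 'a) module \<Rightarrow> nat \<Rightarrow> (nat \<Rightarrow> 'a) \<Rightarrow> ((nat \<Rightarrow> 'a) \<Rightarrow> complex) set"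
  where "pure_tensor A n a =
    tensor_relation_space A n +>\<^bsub>free_space (tuples A n)\<^esub> basis_vector a"

text \<open>The linear map \<open>a\<^sub>0 \<otimes> \<dots> \<otimes> a\<^sub>n \<mapsto> F (a\<^sub>0, \<dots>, a\<^sub>n)\<close>, for \<open>F\<close> multilinear.\<close>

definition tensor_lift ::
  "(complex, 'a) module \<Rightarrow> nat \<Rightarrow> (complex, 'v) module \<Rightarrow> ((nat \<Rightarrow> 'a) \<Rightarrow> 'v) \<Rightarrow>
   ((nat \<Rightarrow> 'a) \<Rightarrow> complex) set \<Rightarrow> 'v"
  where "tensor_lift A n M F =
    (THE f. f \<in> Lin (tensor_power A n) M \<and> (\<forall>a\<in>tuples A n. f (pure_tensor A n a) = F a))"


section \<open>Finite pointed sets and the category \<open>\<Gamma>\<close>\<close>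

text \<open>A pointed set is a pair of a set and its base point; \<open>Gamma_obj n\<close> is \<open>[n]\<close>.\<close>

definition pointed_finite_set :: "'t set \<times> 't \<Rightarrow> bool"
  where "pointed_finite_set T \<longleftrightarrow> finite (fst T) \<and> snd T \<in> fst T"

definition pointed_maps :: "'s set \<times> 's \<Rightarrow> 't set \<times> 't \<Rightarrow> ('s \<Rightarrow> 't) set"
  where "pointed_maps S T = {f \<in> fst S \<rightarrow>\<^sub>E fst T. f (snd S) = snd T}"

definition Gamma_obj :: "nat \<Rightarrow> nat set \<times> nat"
  where "Gamma_obj n = ({0..n}, 0)"


section \<open>The functor \<open>\<L>(A)\<close>\<close>

definition Loday_Gamma_map ::
  "(complex, 'a) module \<Rightarrow> nat \<Rightarrow> nat \<Rightarrow> (nat \<Rightarrow> nat) \<Rightarrow>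
   ((nat \<Rightarrow> 'a) \<Rightarrow> complex) set \<Rightarrow> ((nat \<Rightarrow> 'a) \<Rightarrow> complex) set"
  where "Loday_Gamma_map A m n \<phi> =
    tensor_lift A m (tensor_power A n)
      (\<lambda>a. pure_tensor A n (\<lambda>j\<in>{0..n}. \<Otimes>\<^bsub>A\<^esub>i\<in>{i \<in> {0..m}. \<phi> i = j}. a i))"

text \<open>
  The extension to a finite pointed set \<open>T\<close> is the colimit of \<open>\<L>(A)\<close> over the category of
  objects \<open>\<phi> : [m] \<rightarrow> T\<close> of \<open>\<Gamma>\<close> over \<open>T\<close>, whose morphisms from \<open>\<psi> \<circ> \<alpha> : [m] \<rightarrow> T\<close> to
  \<open>\<psi> : [n] \<rightarrow> T\<close> are the morphisms \<open>\<alpha> : [m] \<rightarrow> [n]\<close> of \<open>\<Gamma>\<close>. It is formed as the usual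
  quotient of the direct sum over all objects.
\<close>

definition Gamma_over :: "'t set \<times> 't \<Rightarrow> (nat \<times> (nat \<Rightarrow> 't)) set"
  where "Gamma_over T = {(m, \<phi>). \<phi> \<in> pointed_maps (Gamma_obj m) T}"

definition Loday_sum ::
  "(complex, 'a) module \<Rightarrow> 't set \<times> 't \<Rightarrow>
   (complex, nat \<times> (nat \<Rightarrow> 't) \<Rightarrow> ((nat \<Rightarrow> 'a) \<Rightarrow> complex) set) module"
  where "Loday_sum A T = direct_sum (Gamma_over T) (\<lambda>(m, \<phi>). tensor_power A m)"

definition Loday_sum_inj ::
  "(complex, 'a) module \<Rightarrow> 't set \<times> 't \<Rightarrow> nat \<times> (nat \<Rightarrow> 't) \<Rightarrow>
   ((nat \<Rightarrow> 'a) \<Rightarrow> complex) set \<Rightarrow>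
   (nat \<times> (nat \<Rightarrow> 't) \<Rightarrow> ((nat \<Rightarrow> 'a) \<Rightarrow> complex) set)"
  where "Loday_sum_inj A T = summand_inj (Gamma_over T) (\<lambda>(m, \<phi>). tensor_power A m)"

definition Loday_relation_space ::
  "(complex, 'a) module \<Rightarrow> 't set \<times> 't \<Rightarrow>
   (nat \<times> (nat \<Rightarrow> 't) \<Rightarrow> ((nat \<Rightarrow> 'a) \<Rightarrow> complex) set) set"
  where "Loday_relation_space A T =
    subspace_span (Loday_sum A T)
      {Loday_sum_inj A T (m, compose {0..m} \<psi> \<alpha>) x \<ominus>\<^bsub>Loday_sum A T\<^esub>
         Loday_sum_inj A T (n, \<psi>) (Loday_Gamma_map A m n \<alpha> x)
        | m n \<alpha> \<psi> x. \<alpha> \<in> pointed_maps (Gamma_obj m) (Gamma_obj n) \<and>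
            \<psi> \<in> pointed_maps (Gamma_obj n) T \<and> x \<in> carrier (tensor_power A m)}"

type_synonym ('a, 't) Loday_elem =
  "(nat \<times> (nat \<Rightarrow> 't) \<Rightarrow> ((nat \<Rightarrow> 'a) \<Rightarrow> complex) set) set"

definition Loday ::
  "(complex, 'a) module \<Rightarrow> 't set \<times> 't \<Rightarrow> (complex, ('a, 't) Loday_elem) module"
  where "Loday A T = quotient_space (Loday_sum A T) (Loday_relation_space A T)"

definition Loday_inj ::
  "(complex, 'a) module \<Rightarrow> 't set \<times> 't \<Rightarrow> nat \<times> (nat \<Rightarrow> 't) \<Rightarrow>
   ((nat \<Rightarrow> 'a) \<Rightarrow> complex) set \<Rightarrow> ('a, 't) Loday_elem"
  where "Loday_inj A T z x =
    Loday_relation_space A T +>\<^bsub>Loday_sum A T\<^esub> Loday_sum_inj A T z x"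

definition Loday_map ::
  "(complex, 'a) module \<Rightarrow> 's set \<times> 's \<Rightarrow> 't set \<times> 't \<Rightarrow> ('s \<Rightarrow> 't) \<Rightarrow>
   ('a, 's) Loday_elem \<Rightarrow> ('a, 't) Loday_elem"
  where "Loday_map A S T f =
    (THE g. g \<in> Lin (Loday A S) (Loday A T) \<and>
      (\<forall>(m, \<phi>)\<in>Gamma_over S. \<forall>x\<in>carrier (tensor_power A m).
        g (Loday_inj A S (m, \<phi>) x) = Loday_inj A T (m, compose {0..m} f \<phi>) x))"


section \<open>Pointed simplicial finite sets\<close>

definition simplex_maps :: "nat \<Rightarrow> nat \<Rightarrow> (nat \<Rightarrow> nat) set"
  where "simplex_maps m n = {\<theta> \<in> {0..m} \<rightarrow>\<^sub>E {0..n}. mono_on {0..m} \<theta>}"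

text \<open>
  \<open>Y n\<close> is the value of the functor on the ordinal \<open>{0 < \<dots> < n}\<close>, and
  \<open>Y_map m n \<theta>\<close> is the map \<open>Y n \<rightarrow> Y m\<close> induced by \<open>\<theta> : {0 < \<dots> < m} \<rightarrow> {0 < \<dots> < n}\<close>.
\<close>

locale pointed_simplicial_finite_set =
  fixes Y :: "nat \<Rightarrow> 'y set \<times> 'y"
    and Y_map :: "nat \<Rightarrow> nat \<Rightarrow> (nat \<Rightarrow> nat) \<Rightarrow> 'y \<Rightarrow> 'y"
  assumes pointed_finite: "pointed_finite_set (Y n)"
    and Y_map_closed: "\<theta> \<in> simplex_maps m n \<Longrightarrow> Y_map m n \<theta> \<in> pointed_maps (Y n) (Y m)"
    and Y_map_id: "Y_map n n (\<lambda>i\<in>{0..n}. i) = (\<lambda>y\<in>fst (Y n). y)"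
    and Y_map_compose: "\<eta> \<in> simplex_maps l m \<Longrightarrow> \<theta> \<in> simplex_maps m n \<Longrightarrow>
      Y_map l n (compose {0..l} \<theta> \<eta>) = compose (fst (Y n)) (Y_map l m \<eta>) (Y_map m n \<theta>)"

definition coface :: "nat \<Rightarrow> nat \<Rightarrow> nat \<Rightarrow> nat"
  where "coface n i = (\<lambda>j\<in>{0..n - 1}. if j < i then j else j + 1)"


section \<open>The \<open>N\<close>-complex \<open>(\<L>\<^sup>Y(A), \<^sub>qb)\<close>\<close>

definition Loday_complex ::
  "(complex, 'a) module \<Rightarrow> (nat \<Rightarrow> 'y set \<times> 'y) \<Rightarrow> int \<Rightarrow> (complex, ('a, 'y) Loday_elem) module"
  where "Loday_complex A Y n = (if n < 0 then zero_space else Loday A (Y (nat n)))"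

definition face_map ::
  "(complex, 'a) module \<Rightarrow> (nat \<Rightarrow> 'y set \<times> 'y) \<Rightarrow>
   (nat \<Rightarrow> nat \<Rightarrow> (nat \<Rightarrow> nat) \<Rightarrow> 'y \<Rightarrow> 'y) \<Rightarrow> nat \<Rightarrow> nat \<Rightarrow>
   ('a, 'y) Loday_elem \<Rightarrow> ('a, 'y) Loday_elem"
  where "face_map A Y Y_map n i = Loday_map A (Y n) (Y (n - 1)) (Y_map (n - 1) n (coface n i))"

definition q_boundary ::
  "complex \<Rightarrow> (complex, 'a) module \<Rightarrow> (nat \<Rightarrow> 'y set \<times> 'y) \<Rightarrow>
   (nat \<Rightarrow> nat \<Rightarrow> (nat \<Rightarrow> nat) \<Rightarrow> 'y \<Rightarrow> 'y) \<Rightarrow> int \<Rightarrow>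
   ('a, 'y) Loday_elem \<Rightarrow> ('a, 'y) Loday_elem"
  where "q_boundary q A Y Y_map n = (\<lambda>x\<in>carrier (Loday_complex A Y n).
    if n \<le> 0 then \<zero>\<^bsub>Loday_complex A Y (n - 1)\<^esub>
    else \<Oplus>\<^bsub>Loday_complex A Y (n - 1)\<^esub>i\<in>{0..nat n}.
      (q ^ i) \<odot>\<^bsub>Loday_complex A Y (n - 1)\<^esub> face_map A Y Y_map (nat n) i x)"


section \<open>Homology of \<open>N\<close>-complexes\<close>

text \<open>
  The maps are \<open>b n : C n \<rightarrow> C (n - 1)\<close>, and \<open>iterate b i n\<close> is \<open>b\<^sup>i : C n \<rightarrow> C (n - i)\<close>.
  In an \<open>N\<close>-complex the image of \<open>b\<^sup>N\<^sup>-\<^sup>i\<close> is contained in the kernel of \<open>b\<^sup>i\<close>, so that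
  \<open>N_homology\<close> is an honest quotient of the kernel.
\<close>

fun iterate :: "(int \<Rightarrow> 'v \<Rightarrow> 'v) \<Rightarrow> nat \<Rightarrow> int \<Rightarrow> 'v \<Rightarrow> 'v"
  where
    "iterate b 0 n x = x"
  | "iterate b (Suc i) n x = b (n - int i) (iterate b i n x)"

definition N_cycles ::
  "(int \<Rightarrow> (complex, 'v) module) \<Rightarrow> (int \<Rightarrow> 'v \<Rightarrow> 'v) \<Rightarrow> nat \<Rightarrow> int \<Rightarrow> 'v set"
  where "N_cycles C b i n = {x \<in> carrier (C n). iterate b i n x = \<zero>\<^bsub>C (n - int i)\<^esub>}"

definition N_boundaries ::
  "nat \<Rightarrow> (int \<Rightarrow> (complex, 'v) module) \<Rightarrow> (int \<Rightarrow> 'v \<Rightarrow> 'v) \<Rightarrow> nat \<Rightarrow> int \<Rightarrow> 'v set"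
  where "N_boundaries N C b i n =
    iterate b (N - i) (n + int (N - i)) ` carrier (C (n + int (N - i)))"

definition N_homology ::
  "nat \<Rightarrow> (int \<Rightarrow> (complex, 'v) module) \<Rightarrow> (int \<Rightarrow> 'v \<Rightarrow> 'v) \<Rightarrow> nat \<Rightarrow> int \<Rightarrow>
   (complex, 'v set) module"
  where "N_homology N C b i n =
    quotient_space ((C n)\<lparr>carrier := N_cycles C b i n\<rparr>) (N_boundaries N C b i n)"

definition homology_class ::
  "nat \<Rightarrow> (int \<Rightarrow> (complex, 'v) module) \<Rightarrow> (int \<Rightarrow> 'v \<Rightarrow> 'v) \<Rightarrow> nat \<Rightarrow> int \<Rightarrow> 'v \<Rightarrow> 'v set"
  where "homology_class N C b i n x = N_boundaries N C b i n +>\<^bsub>C n\<^esub> x"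

definition homology_object ::
  "nat \<Rightarrow> (int \<Rightarrow> (complex, 'v) module) \<Rightarrow> (int \<Rightarrow> 'v \<Rightarrow> 'v) \<Rightarrow> int \<Rightarrow>
   (complex, nat \<Rightarrow> 'v set) module"
  where "homology_object N C b n = direct_sum {1..N - 1} (\<lambda>i. N_homology N C b i n)"

definition total_homology ::
  "nat \<Rightarrow> (int \<Rightarrow> (complex, 'v) module) \<Rightarrow> (int \<Rightarrow> 'v \<Rightarrow> 'v) \<Rightarrow>
   (complex, nat \<Rightarrow> nat \<Rightarrow> 'v set) module"
  where "total_homology N C b = direct_sum UNIV (\<lambda>n. homology_object N C b (int n))"

text \<open>
  The class of \<open>x\<close> in the summand \<open>H\<^bsub>{i,n}\<^esub>\<close> of the total homology.
\<close>

definition total_class ::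
  "nat \<Rightarrow> (int \<Rightarrow> (complex, 'v) module) \<Rightarrow> (int \<Rightarrow> 'v \<Rightarrow> 'v) \<Rightarrow> nat \<Rightarrow> nat \<Rightarrow> 'v \<Rightarrow>
   (nat \<Rightarrow> nat \<Rightarrow> 'v set)"
  where "total_class N C b i n x =
    summand_inj UNIV (\<lambda>n. homology_object N C b (int n)) n
      (summand_inj {1..N - 1} (\<lambda>i. N_homology N C b i (int n)) i
        (homology_class N C b i (int n) x))"

definition q_Hochschild ::
  "nat \<Rightarrow> complex \<Rightarrow> (complex, 'a) module \<Rightarrow> (nat \<Rightarrow> 'y set \<times> 'y) \<Rightarrow>
   (nat \<Rightarrow> nat \<Rightarrow> (nat \<Rightarrow> nat) \<Rightarrow> 'y \<Rightarrow> 'y) \<Rightarrow>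
   (complex, nat \<Rightarrow> nat \<Rightarrow> ('a, 'y) Loday_elem set) module"
  where "q_Hochschild N q A Y Y_map =
    total_homology N (Loday_complex A Y) (q_boundary q A Y Y_map)"

definition primitive_root_of_unity :: "nat \<Rightarrow> complex \<Rightarrow> bool"
  where "primitive_root_of_unity N q \<longleftrightarrow> q ^ N = 1 \<and> (\<forall>m. 0 < m \<and> m < N \<longrightarrow> q ^ m \<noteq> 1)"


section \<open>Higher derivations\<close>

definition higher_derivation :: "(complex, 'a) module \<Rightarrow> (nat \<Rightarrow> 'a \<Rightarrow> 'a) \<Rightarrow> bool"
  where "higher_derivation A D \<longleftrightarrow>
    (\<forall>n. linear_map A A (D n)) \<and>
    (\<forall>n. \<forall>a\<in>carrier A. \<forall>a'\<in>carrier A.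
      D n (a \<otimes>\<^bsub>A\<^esub> a') = (\<Oplus>\<^bsub>A\<^esub>i\<in>{0..n}. D i a \<otimes>\<^bsub>A\<^esub> D (n - i) a'))"

definition normalized_derivation :: "(complex, 'a) module \<Rightarrow> (nat \<Rightarrow> 'a \<Rightarrow> 'a) \<Rightarrow> bool"
  where "normalized_derivation A D \<longleftrightarrow> (\<forall>a\<in>carrier A. D 0 a = a)"

definition L_Gamma ::
  "(complex, 'a) module \<Rightarrow> (nat \<Rightarrow> 'a \<Rightarrow> 'a) \<Rightarrow> nat \<Rightarrow> nat \<Rightarrow>
   ((nat \<Rightarrow> 'a) \<Rightarrow> complex) set \<Rightarrow> ((nat \<Rightarrow> 'a) \<Rightarrow> complex) set"
  where "L_Gamma A D k n =
    tensor_lift A n (tensor_power A n)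
      (\<lambda>a. \<Oplus>\<^bsub>tensor_power A n\<^esub>p\<in>{p \<in> {0..n} \<rightarrow>\<^sub>E UNIV. (\<Sum>i\<in>{0..n}. p i) = k}.
        pure_tensor A n (\<lambda>i\<in>{0..n}. D (p i) (a i)))"

definition L_map ::
  "(complex, 'a) module \<Rightarrow> (nat \<Rightarrow> 'a \<Rightarrow> 'a) \<Rightarrow> nat \<Rightarrow> 't set \<times> 't \<Rightarrow>
   ('a, 't) Loday_elem \<Rightarrow> ('a, 't) Loday_elem"
  where "L_map A D k T =
    (THE g. g \<in> Lin (Loday A T) (Loday A T) \<and>
      (\<forall>(m, \<phi>)\<in>Gamma_over T. \<forall>x\<in>carrier (tensor_power A m).
        g (Loday_inj A T (m, \<phi>) x) = Loday_inj A T (m, \<phi>) (L_Gamma A D k m x)))"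

end

theory Submission
  imports Defs
begin

text \<open>
  The operator \<open>L\<^sub>D\<^sup>k\<close> commutes with the maps of the Loday functor, hence with the face maps of
  the simplicial vector space and with every linear combination of them, in particular with the
  boundary \<open>b = \<Sum> q\<^sup>i d\<^sub>i\<close>. A map commuting with \<open>b\<close> commutes with the powers of \<open>b\<close>, so it
  preserves their kernels and images and acts on the homology objects.

  The one point that uses the higher derivation is naturality over \<open>\<Gamma>\<close>, lemma
  \<open>L_Gamma_natural\<close>. For \<open>\<phi> : [m] \<rightarrow> [n]\<close> both composites send \<open>a\<^sub>0 \<otimes> \<dots> \<otimes> a\<^sub>m\<close> to the sum over all
  \<open>p\<^sub>0 + \<dots> + p\<^sub>m = k\<close> of the tensors with \<open>j\<close>-th factor the product of the \<open>D\<^bsub>p\<^sub>i\<^esub>(a\<^sub>i)\<close> over the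
  fibre \<open>\<phi> i = j\<close>: on the one side this is the definition, on the other side it follows by
  expanding \<open>D\<^sub>r\<close> of each fibre product with the iterated Leibniz rule (\<open>D_finprod\<close>), expanding the
  tensor by multilinearity (\<open>multilinear_expand\<close>), and regrouping the sum according to the sums of
  \<open>p\<close> along the fibres (\<open>bij_weak_compositions_fibres\<close>). An empty fibre contributes the factor \<open>1\<close>,
  and there one needs \<open>D\<^sub>0(1) = 1\<close> and \<open>D\<^sub>k(1) = 0\<close> for \<open>k > 0\<close> (\<open>D_one\<close>).

  The remaining work is to establish the universal properties by which the maps in question are
  defined: of free spaces, quotients and direct sums, then of tensor powers (\<open>tensor_lift\<close>), of
  the colimit (\<open>Loday_lift\<close>) and of the total homology (\<open>total_homology_lift\<close>).
\<close>

section \<open>Linear algebra over the complex numbers\<close>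

lemma complex_ring_simps [simp]:
  "carrier \<C> = UNIV" "a \<otimes>\<^bsub>\<C>\<^esub> b = a * b" "a \<oplus>\<^bsub>\<C>\<^esub> b = a + b" "\<one>\<^bsub>\<C>\<^esub> = 1" "\<zero>\<^bsub>\<C>\<^esub> = 0"
  by (simp_all add: ring_of_type_algebra_def)

text \<open>Negatives need no separate hypothesis: \<open>- x\<close> is \<open>(- 1) \<odot> x\<close>.\<close>

lemma module_complexI:
  fixes M :: "(complex, 'v) module" (structure)
  assumes "\<zero> \<in> carrier M"
    and "\<And>x y. x \<in> carrier M \<Longrightarrow> y \<in> carrier M \<Longrightarrow> x \<oplus> y \<in> carrier M"
    and "\<And>x y z. x \<in> carrier M \<Longrightarrow> y \<in> carrier M \<Longrightarrow> z \<in> carrier M \<Longrightarrow>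
      (x \<oplus> y) \<oplus> z = x \<oplus> (y \<oplus> z)"
    and "\<And>x y. x \<in> carrier M \<Longrightarrow> y \<in> carrier M \<Longrightarrow> x \<oplus> y = y \<oplus> x"
    and l_zero: "\<And>x. x \<in> carrier M \<Longrightarrow> \<zero> \<oplus> x = x"
    and smult: "\<And>c x. x \<in> carrier M \<Longrightarrow> c \<odot> x \<in> carrier M"
    and l_distr: "\<And>a b x. x \<in> carrier M \<Longrightarrow> (a + b) \<odot> x = a \<odot> x \<oplus> b \<odot> x"
    and "\<And>a x y. x \<in> carrier M \<Longrightarrow> y \<in> carrier M \<Longrightarrow> a \<odot> (x \<oplus> y) = a \<odot> x \<oplus> a \<odot> y"
    and "\<And>a b x. x \<in> carrier M \<Longrightarrow> (a * b) \<odot> x = a \<odot> (b \<odot> x)"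
    and one: "\<And>x. x \<in> carrier M \<Longrightarrow> 1 \<odot> x = x"
    and null: "\<And>x. x \<in> carrier M \<Longrightarrow> 0 \<odot> x = \<zero>"
  shows "module \<C> M"
proof (rule moduleI)
  show "abelian_group M"
  proof (rule abelian_groupI)
    fix x assume x: "x \<in> carrier M"
    have "(- 1) \<odot> x \<oplus> x = (- 1 + 1) \<odot> x"
      using l_distr[OF x, of "- 1" 1] one[OF x] by simp
    then show "\<exists>y\<in>carrier M. y \<oplus> x = \<zero>"
      using null[OF x] smult[OF x] by auto
  qed (use assms in auto)
qed (use assms in auto)


subsection \<open>Linear maps\<close>

lemma linear_mapI:
  assumes "\<And>x. x \<in> carrier M \<Longrightarrow> f x \<in> carrier M'"
    and "\<And>x y. x \<in> carrier M \<Longrightarrow> y \<in> carrier M \<Longrightarrow> f (x \<oplus>\<^bsub>M\<^esub> y) = f x \<oplus>\<^bsub>M'\<^esub> f y"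
    and "\<And>c x. x \<in> carrier M \<Longrightarrow> f (c \<odot>\<^bsub>M\<^esub> x) = c \<odot>\<^bsub>M'\<^esub> f x"
  shows "linear_map M M' f"
  using assms by (auto simp: linear_map_def)

lemma linear_map_closed: "linear_map M M' f \<Longrightarrow> x \<in> carrier M \<Longrightarrow> f x \<in> carrier M'"
  and linear_map_add: "linear_map M M' f \<Longrightarrow> x \<in> carrier M \<Longrightarrow> y \<in> carrier M \<Longrightarrow>
    f (x \<oplus>\<^bsub>M\<^esub> y) = f x \<oplus>\<^bsub>M'\<^esub> f y"
  and linear_map_smult: "linear_map M M' f \<Longrightarrow> x \<in> carrier M \<Longrightarrow>
    f (c \<odot>\<^bsub>M\<^esub> x) = c \<odot>\<^bsub>M'\<^esub> f x"
  by (auto simp: linear_map_def)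

lemma Lin_linear: "f \<in> Lin M M' \<Longrightarrow> linear_map M M' f"
  by (simp add: Lin_def)

lemma Lin_eqI:
  assumes "f \<in> Lin M M'" "g \<in> Lin M M'" "\<And>x. x \<in> carrier M \<Longrightarrow> f x = g x"
  shows "f = g"
  using assms by (auto simp: Lin_def intro: extensionalityI)

lemma linear_map_cong:
  assumes "module \<C> M" "linear_map M M' f" "\<And>x. x \<in> carrier M \<Longrightarrow> f x = g x"
  shows "linear_map M M' g"
proof -
  interpret M: module \<C> M by fact
  show ?thesis
    using assms(2,3) M.smult_closed by (auto simp: linear_map_def Pi_iff)
qed

lemma restrict_Lin:
  assumes "module \<C> M" "linear_map M M' f"
  shows "restrict f (carrier M) \<in> Lin M M'"
  using linear_map_cong[OF assms, of "restrict f (carrier M)"] by (simp add: Lin_def)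

lemma linear_map_compose:
  assumes "linear_map M M' f" "linear_map M' M'' g"
  shows "linear_map M M'' (\<lambda>x. g (f x))"
  using assms by (auto simp: linear_map_def Pi_iff)

lemma linear_map_zero:
  assumes "module \<C> M" "module \<C> M'" "linear_map M M' f"
  shows "f \<zero>\<^bsub>M\<^esub> = \<zero>\<^bsub>M'\<^esub>"
proof -
  interpret M: module \<C> M by fact
  interpret M': module \<C> M' by fact
  have "f \<zero>\<^bsub>M\<^esub> = f (0 \<odot>\<^bsub>M\<^esub> \<zero>\<^bsub>M\<^esub>)"
    using M.smult_r_null[of 0] by simp
  also have "\<dots> = 0 \<odot>\<^bsub>M'\<^esub> f \<zero>\<^bsub>M\<^esub>"
    by (rule linear_map_smult[OF assms(3)]) simp
  also have "\<dots> = \<zero>\<^bsub>M'\<^esub>"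
    using M'.smult_l_null[OF linear_map_closed[OF assms(3) M.zero_closed]] by simp
  finally show ?thesis .
qed

lemma linear_map_minus:
  assumes "module \<C> M" "module \<C> M'" "linear_map M M' f"
    and "x \<in> carrier M" "y \<in> carrier M"
  shows "f (x \<ominus>\<^bsub>M\<^esub> y) = f x \<ominus>\<^bsub>M'\<^esub> f y"
proof -
  interpret M: module \<C> M by fact
  interpret M': module \<C> M' by fact
  have "f (\<ominus>\<^bsub>M\<^esub> y) \<oplus>\<^bsub>M'\<^esub> f y = \<zero>\<^bsub>M'\<^esub>"
    using assms(4,5) by (simp add: linear_map_add[OF assms(3), symmetric] M.l_neg linear_map_zero[OF assms(1-3)])
  then have "f (\<ominus>\<^bsub>M\<^esub> y) = \<ominus>\<^bsub>M'\<^esub> f y"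
    by (intro M'.minus_equality[symmetric] linear_map_closed[OF assms(3)] M.a_inv_closed assms(4,5))
  then show ?thesis
    using assms by (simp add: a_minus_def linear_map_add)
qed

lemma linear_map_finsum:
  assumes "module \<C> M" "module \<C> M'" "linear_map M M' f"
    and "g \<in> I \<rightarrow> carrier M"
  shows "f (\<Oplus>\<^bsub>M\<^esub>i\<in>I. g i) = (\<Oplus>\<^bsub>M'\<^esub>i\<in>I. f (g i))"
proof -
  interpret M: module \<C> M by fact
  interpret M': module \<C> M' by fact
  show ?thesis
    using assms(4)
  proof (induction I rule: infinite_finite_induct)
    case (insert i I)
    then have "f \<circ> g \<in> insert i I \<rightarrow> carrier M'"
      by (auto simp: Pi_iff intro: linear_map_closed[OF assms(3)])
    then have "(\<Oplus>\<^bsub>M'\<^esub>i\<in>insert i I. f (g i)) = f (g i) \<oplus>\<^bsub>M'\<^esub> (\<Oplus>\<^bsub>M'\<^esub>i\<in>I. f (g i))"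
      using insert by (subst M'.finsum_insert) auto
    moreover have "f (\<Oplus>\<^bsub>M\<^esub>i\<in>insert i I. g i) = f (g i) \<oplus>\<^bsub>M'\<^esub> f (\<Oplus>\<^bsub>M\<^esub>i\<in>I. g i)"
      using insert.hyps insert.prems
      by (subst M.finsum_insert) (auto intro!: linear_map_add[OF assms(3)] M.finsum_closed)
    ultimately show ?case
      using insert by auto
  qed (use linear_map_zero[OF assms(1-3)] in auto)
qed

lemma linear_map_sum:
  assumes "module \<C> M" "module \<C> M'" "\<And>i. i \<in> I \<Longrightarrow> linear_map M M' (f i)"
  shows "linear_map M M' (\<lambda>x. \<Oplus>\<^bsub>M'\<^esub>i\<in>I. f i x)"
proof (cases "finite I")
  case fin: True
  interpret M: module \<C> M by fact
  interpret M': module \<C> M' by fact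
  have cl: "(\<lambda>i. f i x) \<in> I \<rightarrow> carrier M'" if "x \<in> carrier M" for x
    using that by (auto intro: linear_map_closed[OF assms(3)])
  show ?thesis
  proof (rule linear_mapI)
    fix x y assume xy: "x \<in> carrier M" "y \<in> carrier M"
    have "(\<Oplus>\<^bsub>M'\<^esub>i\<in>I. f i (x \<oplus>\<^bsub>M\<^esub> y)) = (\<Oplus>\<^bsub>M'\<^esub>i\<in>I. f i x \<oplus>\<^bsub>M'\<^esub> f i y)"
      using xy by (intro M'.finsum_cong') (auto simp: linear_map_add[OF assms(3)] Pi_iff
          intro: linear_map_closed[OF assms(3)])
    then show "(\<Oplus>\<^bsub>M'\<^esub>i\<in>I. f i (x \<oplus>\<^bsub>M\<^esub> y)) = (\<Oplus>\<^bsub>M'\<^esub>i\<in>I. f i x) \<oplus>\<^bsub>M'\<^esub> (\<Oplus>\<^bsub>M'\<^esub>i\<in>I. f i y)"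
      using xy cl by (simp add: M'.finsum_addf)
  next
    fix c x assume x: "x \<in> carrier M"
    have "(\<Oplus>\<^bsub>M'\<^esub>i\<in>I. f i (c \<odot>\<^bsub>M\<^esub> x)) = (\<Oplus>\<^bsub>M'\<^esub>i\<in>I. c \<odot>\<^bsub>M'\<^esub> f i x)"
      using x by (intro M'.finsum_cong') (auto simp: linear_map_smult[OF assms(3)] Pi_iff
          intro: linear_map_closed[OF assms(3)] M'.smult_closed)
    then show "(\<Oplus>\<^bsub>M'\<^esub>i\<in>I. f i (c \<odot>\<^bsub>M\<^esub> x)) = c \<odot>\<^bsub>M'\<^esub> (\<Oplus>\<^bsub>M'\<^esub>i\<in>I. f i x)"
      using x cl fin by (simp add: M'.finsum_smult_ldistr)
  qed (use cl in \<open>auto intro: M'.finsum_closed\<close>)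
next
  \<comment> \<open>A sum over an infinite index set is zero by convention.\<close>
  case False
  interpret M: module \<C> M by fact
  interpret M': module \<C> M' by fact
  show ?thesis
    by (rule linear_mapI) (use False M'.smult_r_null in auto)
qed

lemma linear_map_smult_right:
  assumes "module \<C> M'" "linear_map M M' f"
  shows "linear_map M M' (\<lambda>x. c \<odot>\<^bsub>M'\<^esub> f x)"
proof -
  interpret M': module \<C> M' by fact
  show ?thesis
    using linear_map_closed[OF assms(2)] M'.smult_r_distr[of c] M'.smult_assoc1[of c]
      M'.smult_assoc1[of _ c] M'.smult_closed
    by (intro linear_mapI) (simp_all add: linear_map_add[OF assms(2)] linear_map_smult[OF assms(2)] mult.commute)
qed

lemma linear_map_const_zero:
  assumes "module \<C> M'"
  shows "linear_map M M' (\<lambda>x. \<zero>\<^bsub>M'\<^esub>)"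
proof -
  interpret M': module \<C> M' by fact
  show ?thesis
    by (intro linear_mapI) (simp_all add: M'.smult_r_null)
qed


subsection \<open>Subspaces and spans\<close>

lemma submodule_equalizer:
  assumes "module \<C> M" "module \<C> M'" "linear_map M M' f" "linear_map M M' g"
  shows "submodule {x \<in> carrier M. f x = g x} \<C> M"
proof -
  interpret M: module \<C> M by fact
  interpret M': module \<C> M' by fact
  have inv: "h (\<ominus>\<^bsub>M\<^esub> x) = \<ominus>\<^bsub>M'\<^esub> h x" if "linear_map M M' h" "x \<in> carrier M" for h x
    using linear_map_minus[OF assms(1,2) that(1) M.zero_closed that(2)] that
    by (simp add: M.minus_eq M'.minus_eq linear_map_closed linear_map_zero[OF assms(1,2)])
  show ?thesis
    by (rule M.submoduleI)
      (use assms in \<open>auto simp: linear_map_add linear_map_smult linear_map_zero inv M.smult_closed\<close>)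
qed

lemma submodule_image:
  assumes "module \<C> M" "module \<C> M'" "linear_map M M' f"
  shows "submodule (f ` carrier M) \<C> M'"
proof -
  interpret M: module \<C> M by fact
  interpret M': module \<C> M' by fact
  have inv: "\<ominus>\<^bsub>M'\<^esub> f x = f (\<ominus>\<^bsub>M\<^esub> x)" if "x \<in> carrier M" for x
    using linear_map_minus[OF assms M.zero_closed that] that linear_map_closed[OF assms(3) that]
    by (simp add: M.minus_eq M'.minus_eq linear_map_zero[OF assms])
  show ?thesis
  proof (rule M'.submoduleI)
    show "\<zero>\<^bsub>M'\<^esub> \<in> f ` carrier M"
      using linear_map_zero[OF assms] by (metis M.zero_closed imageI)
  qed (use assms(3) in \<open>auto simp: inv linear_map_closed M.smult_closed
        linear_map_add[OF assms(3), symmetric] linear_map_smult[OF assms(3), symmetric]\<close>)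
qed

lemma submodule_kernel:
  assumes "module \<C> M" "module \<C> M'" "linear_map M M' f"
  shows "submodule {x \<in> carrier M. f x = \<zero>\<^bsub>M'\<^esub>} \<C> M"
  using submodule_equalizer[OF assms linear_map_const_zero[OF assms(2)]] by simp

lemma subspace_span_least: "submodule W \<C> M \<Longrightarrow> S \<subseteq> W \<Longrightarrow> subspace_span M S \<subseteq> W"
  by (auto simp: subspace_span_def)

lemma subspace_span_superset: "S \<subseteq> subspace_span M S"
  by (auto simp: subspace_span_def)

lemma submodule_subspace_span:
  assumes "module \<C> M" "S \<subseteq> carrier M"
  shows "submodule (subspace_span M S) \<C> M"
proof -
  interpret M: module \<C> M by fact
  have car: "subspace_span M S \<subseteq> carrier M"
    by (rule subspace_span_least[OF M.carrier_is_submodule assms(2)])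
  show ?thesis
  proof (rule M.submoduleI[OF car])
    show "\<zero>\<^bsub>M\<^esub> \<in> subspace_span M S"
      using subgroup.one_closed[OF submodule.axioms(1)] by (fastforce simp: subspace_span_def)
  next
    fix c x assume x: "x \<in> subspace_span M S"
    show "c \<odot>\<^bsub>M\<^esub> x \<in> subspace_span M S"
      using x M.submoduleE(4) unfolding subspace_span_def by fastforce
  qed (auto simp: subspace_span_def dest: M.submoduleE)
qed

lemma linear_maps_eq_on_span:
  assumes "module \<C> M" "module \<C> M'" "linear_map M M' f" "linear_map M M' g"
    and "subspace_span M S = carrier M" "\<And>x. x \<in> S \<Longrightarrow> f x = g x" "x \<in> carrier M"
  shows "f x = g x"
proof -
  have "S \<subseteq> {x \<in> carrier M. f x = g x}"
    using assms(6) subspace_span_superset[of S M] unfolding assms(5) by auto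
  then have "subspace_span M S \<subseteq> {x \<in> carrier M. f x = g x}"
    by (rule subspace_span_least[OF submodule_equalizer[OF assms(1-4)]])
  then show ?thesis
    using assms(5,7) by auto
qed

lemma linear_map_zero_on_span:
  assumes "module \<C> M" "module \<C> M'" "linear_map M M' f"
    and "S \<subseteq> carrier M" "\<And>x. x \<in> S \<Longrightarrow> f x = \<zero>\<^bsub>M'\<^esub>" "x \<in> subspace_span M S"
  shows "f x = \<zero>\<^bsub>M'\<^esub>"
  using subspace_span_least[OF submodule_kernel[OF assms(1-3)], of S] assms(4-6) by auto


lemma subspace_span_surj_image:
  assumes "module \<C> M" "module \<C> Q" "linear_map M Q p" "p ` carrier M = carrier Q"
    and "subspace_span M S = carrier M"
  shows "subspace_span Q (p ` S) = carrier Q"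
proof
  interpret M: module \<C> M by fact
  interpret Q: module \<C> Q by fact
  have S: "S \<subseteq> carrier M"
    using subspace_span_superset[of S M] assms(5) by simp
  then have pS: "p ` S \<subseteq> carrier Q"
    using assms(4) by auto
  then show "subspace_span Q (p ` S) \<subseteq> carrier Q"
    by (intro subspace_span_least Q.carrier_is_submodule)
  let ?W = "subspace_span Q (p ` S)"
  have W: "submodule ?W \<C> Q"
    by (rule submodule_subspace_span[OF assms(2) pS])
  have inv: "p (\<ominus>\<^bsub>M\<^esub> x) = \<ominus>\<^bsub>Q\<^esub> p x" if "x \<in> carrier M" for x
    using linear_map_minus[OF assms(1-3) M.zero_closed that] that linear_map_closed[OF assms(3) that]
    by (simp add: M.minus_eq Q.minus_eq linear_map_zero[OF assms(1-3)])
  have "submodule {x \<in> carrier M. p x \<in> ?W} \<C> M"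
    using subgroup.one_closed[OF submodule.axioms(1)[OF W]]
    by (intro M.submoduleI) (auto simp: linear_map_zero[OF assms(1-3)] inv linear_map_add[OF assms(3)]
        linear_map_smult[OF assms(3)] M.smult_closed intro: Q.submoduleE(3-5)[OF W])
  moreover have "S \<subseteq> {x \<in> carrier M. p x \<in> ?W}"
    using S subspace_span_superset[of "p ` S" Q] by auto
  ultimately have "carrier M \<subseteq> {x \<in> carrier M. p x \<in> ?W}"
    unfolding assms(5)[symmetric] by (rule subspace_span_least)
  then show "carrier Q \<subseteq> ?W"
    unfolding assms(4)[symmetric] by blast
qed


subsection \<open>Quotients\<close>

text \<open>
  A set with operations is a vector space if a vector space maps onto it compatibly with the
  operations; every linear map that kills the kernel then factors through this surjection.
\<close>

lemma module_surj_image: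
  assumes "module \<C> M" "linear_map M Q p" "p ` carrier M = carrier Q" "p \<zero>\<^bsub>M\<^esub> = \<zero>\<^bsub>Q\<^esub>"
  shows "module \<C> Q"
proof -
  interpret M: module \<C> M by fact
  have *: "\<exists>x'. x' \<in> carrier M \<and> x = p x'" if "x \<in> carrier Q" for x
    using that assms(3) by auto
  note l = linear_map_add[OF assms(2), symmetric] linear_map_smult[OF assms(2), symmetric]
  note c = linear_map_closed[OF assms(2)]
  show ?thesis
    by (rule module_complexI)
      (use M.smult_l_distr M.smult_r_distr M.smult_assoc1 M.smult_one M.smult_l_null assms(4) in
        \<open>auto dest!: * simp: l M.a_ac c assms(4)[symmetric] M.smult_closed\<close>)
qed

lemma surj_factor:
  assumes M: "module \<C> M" and M': "module \<C> M'" and p: "linear_map M Q p"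
    and surj: "p ` carrier M = carrier Q" and zero: "p \<zero>\<^bsub>M\<^esub> = \<zero>\<^bsub>Q\<^esub>"
    and f: "linear_map M M' f"
    and ker: "\<And>x. x \<in> carrier M \<Longrightarrow> p x = \<zero>\<^bsub>Q\<^esub> \<Longrightarrow> f x = \<zero>\<^bsub>M'\<^esub>"
  shows "\<exists>g\<in>Lin Q M'. \<forall>x\<in>carrier M. g (p x) = f x"
proof -
  interpret M: module \<C> M by fact
  interpret M': module \<C> M' by fact
  have Q: "module \<C> Q" by (rule module_surj_image[OF M p surj zero])
  then interpret Q: module \<C> Q .
  define g where "g = (\<lambda>v. f (SOME x. x \<in> carrier M \<and> p x = v))"
  have g: "g (p x) = f x" if x: "x \<in> carrier M" for x
  proof -
    define y where "y = (SOME y. y \<in> carrier M \<and> p y = p x)"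
    have y: "y \<in> carrier M" "p y = p x"
      using someI[of "\<lambda>y. y \<in> carrier M \<and> p y = p x" x] x unfolding y_def by auto
    have 0: "f (y \<ominus>\<^bsub>M\<^esub> x) = \<zero>\<^bsub>M'\<^esub>"
      using x y by (intro ker) (simp_all add: linear_map_minus[OF M Q p] Q.minus_eq
          linear_map_closed[OF p] Q.r_neg)
    have "y = (y \<ominus>\<^bsub>M\<^esub> x) \<oplus>\<^bsub>M\<^esub> x"
      using x y by (simp add: M.minus_eq M.a_assoc M.l_neg)
    then have "f y = f (y \<ominus>\<^bsub>M\<^esub> x) \<oplus>\<^bsub>M'\<^esub> f x"
      using x y(1) by (metis linear_map_add[OF f] M.minus_closed)
    then have "f y = f x"
      using x by (simp add: 0 linear_map_closed[OF f])
    then show ?thesis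
      by (simp add: g_def y_def)
  qed
  have "linear_map Q M' g"
    by (rule linear_mapI)
      (auto simp: surj[symmetric] g linear_map_closed[OF f]
        linear_map_add[OF p, symmetric] linear_map_smult[OF p, symmetric] M.smult_closed
        linear_map_add[OF f] linear_map_smult[OF f])
  with g show ?thesis
    by (intro bexI[OF _ restrict_Lin[OF Q]]) (auto simp: linear_map_closed[OF p])
qed

text \<open>
  The quotient of a subspace \<open>Z\<close> by a subspace \<open>W\<close> of \<open>M\<close> not necessarily contained in \<open>Z\<close>:
  the cosets \<open>W +> x\<close> with \<open>x \<in> Z\<close> form the vector space \<open>(Z + W) / W\<close>.
\<close>

context
  fixes M :: "(complex, 'v) module" and Z W :: "'v set"
  assumes M: "module \<C> M" and Z: "submodule Z \<C> M" and W: "submodule W \<C> M"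
begin

interpretation M: module \<C> M by (rule M)

interpretation W: abelian_subgroup W M
  by (rule abelian_subgroupI3)
    (use W M.abelian_group_axioms in \<open>auto simp: additive_subgroup_def dest: submodule.axioms\<close>)

lemma coset_eq_iff:
  assumes "x \<in> carrier M" "y \<in> carrier M"
  shows "W +>\<^bsub>M\<^esub> x = W +>\<^bsub>M\<^esub> y \<longleftrightarrow> x \<ominus>\<^bsub>M\<^esub> y \<in> W"
proof
  assume "W +>\<^bsub>M\<^esub> x = W +>\<^bsub>M\<^esub> y"
  then have "x \<in> W +>\<^bsub>M\<^esub> y"
    using W.a_rcos_self[OF assms(1)] by simp
  then show "x \<ominus>\<^bsub>M\<^esub> y \<in> W"
    using W.a_rcos_module_imp[OF assms(2)] by (simp add: a_minus_def)
next
  assume "x \<ominus>\<^bsub>M\<^esub> y \<in> W"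
  then have "x \<in> W +>\<^bsub>M\<^esub> y"
    using W.a_rcos_module_rev[OF assms(2,1)] by (simp add: a_minus_def)
  then show "W +>\<^bsub>M\<^esub> x = W +>\<^bsub>M\<^esub> y"
    using W.a_repr_independence'[OF _ assms(2)] W.a_subgroup by auto
qed

lemma coset_eq_zero_iff: "x \<in> carrier M \<Longrightarrow> W +>\<^bsub>M\<^esub> x = W \<longleftrightarrow> x \<in> W"
  using coset_eq_iff[of x "\<zero>\<^bsub>M\<^esub>"] M.a_coset_add_zero[OF W.a_subset]
    M.minus_equality[OF M.l_zero[OF M.zero_closed] M.zero_closed M.zero_closed]
  by (simp add: M.minus_eq)

lemma coset_linear_map:
  "linear_map (M\<lparr>carrier := Z\<rparr>) (quotient_space (M\<lparr>carrier := Z\<rparr>) W) (\<lambda>x. W +>\<^bsub>M\<^esub> x)"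
proof (rule linear_mapI)
  have ZM: "x \<in> carrier M" if "x \<in> Z" for x
    using M.submoduleE(1)[OF Z] that by auto
  fix c x y
  assume x: "x \<in> carrier (M\<lparr>carrier := Z\<rparr>)"
  show "W +>\<^bsub>M\<^esub> x \<in> carrier (quotient_space (M\<lparr>carrier := Z\<rparr>) W)"
    using x by (auto simp: quotient_space_def A_RCOSETS_def' a_r_coset_def')
  have eq: "W +>\<^bsub>M\<^esub> (c \<odot>\<^bsub>M\<^esub> v) = W +>\<^bsub>M\<^esub> (c \<odot>\<^bsub>M\<^esub> x)" if v: "v \<in> W +>\<^bsub>M\<^esub> x" for v
  proof -
    have vM: "v \<in> carrier M"
      using v x ZM W.a_subset by (auto simp: a_r_coset_def')
    have "v \<ominus>\<^bsub>M\<^esub> x \<in> W"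
      using v x ZM W.a_rcos_module_imp by (simp add: a_minus_def)
    then have "c \<odot>\<^bsub>M\<^esub> (v \<ominus>\<^bsub>M\<^esub> x) \<in> W"
      using M.submoduleE(4)[OF W] by simp
    moreover have "c \<odot>\<^bsub>M\<^esub> (v \<ominus>\<^bsub>M\<^esub> x) = c \<odot>\<^bsub>M\<^esub> v \<ominus>\<^bsub>M\<^esub> c \<odot>\<^bsub>M\<^esub> x"
      using vM x ZM by (simp add: a_minus_def M.smult_r_distr M.smult_r_minus)
    ultimately show ?thesis
      using vM x ZM M.smult_closed by (simp add: coset_eq_iff)
  qed
  have "c \<odot>\<^bsub>quotient_space (M\<lparr>carrier := Z\<rparr>) W\<^esub> (W +>\<^bsub>M\<^esub> x) = (\<Union>v\<in>W +>\<^bsub>M\<^esub> x. W +>\<^bsub>M\<^esub> (c \<odot>\<^bsub>M\<^esub> v))"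
    by (simp add: quotient_space_def a_r_coset_def')
  also have "\<dots> = W +>\<^bsub>M\<^esub> (c \<odot>\<^bsub>M\<^esub> x)"
  proof -
    have "W +>\<^bsub>M\<^esub> x \<noteq> {}"
      using W.a_rcos_self x ZM by auto
    then show ?thesis
      by (simp add: SUP_cong[OF refl eq])
  qed
  finally show "W +>\<^bsub>M\<^esub> (c \<odot>\<^bsub>M\<lparr>carrier := Z\<rparr>\<^esub> x) =
      c \<odot>\<^bsub>quotient_space (M\<lparr>carrier := Z\<rparr>) W\<^esub> (W +>\<^bsub>M\<^esub> x)"
    by simp
  assume "y \<in> carrier (M\<lparr>carrier := Z\<rparr>)"
  then show "W +>\<^bsub>M\<^esub> (x \<oplus>\<^bsub>M\<lparr>carrier := Z\<rparr>\<^esub> y) =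
      (W +>\<^bsub>M\<^esub> x) \<oplus>\<^bsub>quotient_space (M\<lparr>carrier := Z\<rparr>) W\<^esub> (W +>\<^bsub>M\<^esub> y)"
    using x ZM W.a_rcos_sum[of x y] by (simp add: quotient_space_def set_add_def')
qed

lemma coset_surj: "(\<lambda>x. W +>\<^bsub>M\<^esub> x) ` Z = carrier (quotient_space (M\<lparr>carrier := Z\<rparr>) W)"
  by (auto simp: quotient_space_def A_RCOSETS_def' a_r_coset_def')

lemma coset_zero: "W +>\<^bsub>M\<^esub> \<zero>\<^bsub>M\<^esub> = \<zero>\<^bsub>quotient_space (M\<lparr>carrier := Z\<rparr>) W\<^esub>"
  using coset_eq_zero_iff W.zero_closed by (simp add: quotient_space_def)

lemma module_subquotient: "module \<C> (quotient_space (M\<lparr>carrier := Z\<rparr>) W)"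
  by (rule module_surj_image[OF submodule.submodule_is_module[OF Z M] coset_linear_map])
    (use coset_surj coset_zero in auto)

lemma subquotient_factor:
  assumes "module \<C> M'" "linear_map (M\<lparr>carrier := Z\<rparr>) M' f"
    and "\<And>x. x \<in> Z \<Longrightarrow> x \<in> W \<Longrightarrow> f x = \<zero>\<^bsub>M'\<^esub>"
  shows "\<exists>g\<in>Lin (quotient_space (M\<lparr>carrier := Z\<rparr>) W) M'. \<forall>x\<in>Z. g (W +>\<^bsub>M\<^esub> x) = f x"
proof -
  have "\<exists>g\<in>Lin (quotient_space (M\<lparr>carrier := Z\<rparr>) W) M'.
      \<forall>x\<in>carrier (M\<lparr>carrier := Z\<rparr>). g (W +>\<^bsub>M\<^esub> x) = f x"
  proof (rule surj_factor[OF submodule.submodule_is_module[OF Z M] assms(1) coset_linear_map _ _ assms(2)])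
    fix x assume "x \<in> carrier (M\<lparr>carrier := Z\<rparr>)"
      "W +>\<^bsub>M\<^esub> x = \<zero>\<^bsub>quotient_space (M\<lparr>carrier := Z\<rparr>) W\<^esub>"
    then show "f x = \<zero>\<^bsub>M'\<^esub>"
      using assms(3) coset_eq_zero_iff M.submoduleE(1)[OF Z] by (auto simp: quotient_space_def)
  qed (use coset_surj coset_zero in auto)
  then show ?thesis by simp
qed

end

text \<open>The case \<open>Z = M\<close> of the above.\<close>

context
  fixes M :: "(complex, 'v) module" and W :: "'v set"
  assumes M: "module \<C> M" and W: "submodule W \<C> M"
begin

interpretation M: module \<C> M by (rule M)

lemma module_quotient: "module \<C> (quotient_space M W)"
  using module_subquotient[OF M M.carrier_is_submodule W] by simp

lemma quotient_eq_iff: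
  assumes "x \<in> carrier M" "y \<in> carrier M"
  shows "W +>\<^bsub>M\<^esub> x = W +>\<^bsub>M\<^esub> y \<longleftrightarrow> x \<ominus>\<^bsub>M\<^esub> y \<in> W"
  by (rule coset_eq_iff[OF M M.carrier_is_submodule W assms])

lemma quotient_linear_map: "linear_map M (quotient_space M W) (\<lambda>x. W +>\<^bsub>M\<^esub> x)"
  using coset_linear_map[OF M M.carrier_is_submodule W] by simp

lemma quotient_surj: "carrier (quotient_space M W) = (\<lambda>x. W +>\<^bsub>M\<^esub> x) ` carrier M"
  using coset_surj[OF M M.carrier_is_submodule W] by simp

lemma quotient_factor:
  assumes "module \<C> M'" "linear_map M M' f" "\<And>x. x \<in> W \<Longrightarrow> f x = \<zero>\<^bsub>M'\<^esub>"
  shows "\<exists>g\<in>Lin (quotient_space M W) M'. \<forall>x\<in>carrier M. g (W +>\<^bsub>M\<^esub> x) = f x"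
  using subquotient_factor[OF M M.carrier_is_submodule W, of M' f] assms by simp

end


subsection \<open>Free spaces and direct sums\<close>

lemma free_space_simps:
  "carrier (free_space S) = {v. finite {x. v x \<noteq> 0} \<and> {x. v x \<noteq> 0} \<subseteq> S}"
  "\<zero>\<^bsub>free_space S\<^esub> = (\<lambda>_. 0)" "v \<oplus>\<^bsub>free_space S\<^esub> w = (\<lambda>x. v x + w x)"
  "c \<odot>\<^bsub>free_space S\<^esub> v = (\<lambda>x. c * v x)"
  by (simp_all add: free_space_def)

lemma module_free_space: "module \<C> (free_space S)"
proof (rule module_complexI)
  fix v w :: "'a \<Rightarrow> complex"
  assume v: "v \<in> carrier (free_space S)" and w: "w \<in> carrier (free_space S)"
  have "{x. v x + w x \<noteq> 0} \<subseteq> {x. v x \<noteq> 0} \<union> {x. w x \<noteq> 0}" by auto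
  moreover have "finite ({x. v x \<noteq> 0} \<union> {x. w x \<noteq> 0})" "{x. v x \<noteq> 0} \<union> {x. w x \<noteq> 0} \<subseteq> S"
    using v w by (auto simp: free_space_simps)
  ultimately show "v \<oplus>\<^bsub>free_space S\<^esub> w \<in> carrier (free_space S)"
    unfolding free_space_simps by (blast intro: finite_subset)
next
  fix v :: "'a \<Rightarrow> complex" and c
  assume v: "v \<in> carrier (free_space S)"
  have "{x. c * v x \<noteq> 0} \<subseteq> {x. v x \<noteq> 0}" by auto
  then show "c \<odot>\<^bsub>free_space S\<^esub> v \<in> carrier (free_space S)"
    using v unfolding free_space_simps by (blast intro: finite_subset)
qed (auto simp: free_space_simps algebra_simps)

lemma basis_vector_closed: "x \<in> S \<Longrightarrow> basis_vector x \<in> carrier (free_space S)"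
  by (auto simp: free_space_simps basis_vector_def)

lemma free_space_span: "subspace_span (free_space S) (basis_vector ` S) = carrier (free_space S)"
proof
  interpret F: module \<C> "free_space S" by (rule module_free_space)
  show "subspace_span (free_space S) (basis_vector ` S) \<subseteq> carrier (free_space S)"
    by (intro subspace_span_least F.carrier_is_submodule) (auto intro: basis_vector_closed)
  let ?W = "subspace_span (free_space S) (basis_vector ` S)"
  have W: "submodule ?W \<C> (free_space S)"
    by (rule submodule_subspace_span[OF module_free_space]) (auto intro: basis_vector_closed)
  have "v \<in> ?W" if "finite U" "U \<subseteq> S" "{x. v x \<noteq> 0} \<subseteq> U" for U and v
    using that
  proof (induction U arbitrary: v)
    \<comment> \<open>\<open>U\<close> is any finite set that contains the support of \<open>v\<close>.\<close>
    case empty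
    then have "v = \<zero>\<^bsub>free_space S\<^esub>" by (auto simp: free_space_simps)
    then show ?case
      using subgroup.one_closed[OF submodule.axioms(1)[OF W]] by simp
  next
    case (insert u U)
    have "v(u := 0) \<in> ?W"
      using insert.prems by (intro insert.IH) auto
    moreover have "v u \<odot>\<^bsub>free_space S\<^esub> basis_vector u \<in> ?W"
      using insert.prems
      by (intro F.submoduleE(4)[OF W] subsetD[OF subspace_span_superset]) auto
    moreover have "v = v(u := 0) \<oplus>\<^bsub>free_space S\<^esub> v u \<odot>\<^bsub>free_space S\<^esub> basis_vector u"
      by (auto simp: free_space_simps basis_vector_def)
    ultimately show ?case
      using F.submoduleE(5)[OF W] by metis
  qed
  then show "carrier (free_space S) \<subseteq> ?W"
    by (auto simp: free_space_simps)
qed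

lemma free_space_lift:
  fixes f :: "'x \<Rightarrow> 'v"
  assumes M: "module \<C> M" and f: "f \<in> S \<rightarrow> carrier M"
  shows "\<exists>g\<in>Lin (free_space S) M. \<forall>x\<in>S. g (basis_vector x) = f x"
proof -
  interpret M: module \<C> M by fact
  define g where "g v = (\<Oplus>\<^bsub>M\<^esub>x\<in>{x. v x \<noteq> 0}. v x \<odot>\<^bsub>M\<^esub> f x)" for v
  have cl: "(\<lambda>x. v x \<odot>\<^bsub>M\<^esub> f x) \<in> U \<rightarrow> carrier M" if "U \<subseteq> S" for U and v :: "'x \<Rightarrow> complex"
    using f that M.smult_closed by (fastforce simp: Pi_iff)
  \<comment> \<open>To compare \<open>g\<close> on vectors of different supports, sum over a common larger set.\<close>
  have g: "g v = (\<Oplus>\<^bsub>M\<^esub>x\<in>U. v x \<odot>\<^bsub>M\<^esub> f x)"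
    if "finite U" "U \<subseteq> S" "{x. v x \<noteq> 0} \<subseteq> U" for U v
    unfolding g_def using that cl f M.smult_l_null
    by (intro M.add.finprod_mono_neutral_cong_left) (auto simp: Pi_iff)
  have lin: "linear_map (free_space S) M g"
  proof (rule linear_mapI)
    fix v w :: "'x \<Rightarrow> complex" and c
    assume v: "v \<in> carrier (free_space S)"
    show "g v \<in> carrier M"
      unfolding g_def using v by (intro M.finsum_closed cl) (auto simp: free_space_simps)
    let ?V = "{x. v x \<noteq> 0}"
    have V: "finite ?V" "?V \<subseteq> S"
      using v by (auto simp: free_space_simps)
    have "g (c \<odot>\<^bsub>free_space S\<^esub> v) = (\<Oplus>\<^bsub>M\<^esub>x\<in>?V. (c * v x) \<odot>\<^bsub>M\<^esub> f x)"
      using V by (subst g[of ?V]) (auto simp: free_space_simps)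
    also have "\<dots> = (\<Oplus>\<^bsub>M\<^esub>x\<in>?V. c \<odot>\<^bsub>M\<^esub> (v x \<odot>\<^bsub>M\<^esub> f x))"
      using V f M.smult_assoc1 M.smult_closed by (intro M.finsum_cong') (auto simp: Pi_iff)
    also have "\<dots> = c \<odot>\<^bsub>M\<^esub> g v"
      unfolding g_def using V cl by (subst M.finsum_smult_ldistr) auto
    finally show "g (c \<odot>\<^bsub>free_space S\<^esub> v) = c \<odot>\<^bsub>M\<^esub> g v" .
    assume "w \<in> carrier (free_space S)"
    then obtain U where U: "finite U" "U \<subseteq> S" "?V \<subseteq> U" "{x. w x \<noteq> 0} \<subseteq> U"
      using V that[of "?V \<union> {x. w x \<noteq> 0}"] by (auto simp: free_space_simps)
    have supp: "{x. v x + w x \<noteq> 0} \<subseteq> U"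
      using U(3,4) by (force simp: subset_iff)
    have "g (v \<oplus>\<^bsub>free_space S\<^esub> w) = (\<Oplus>\<^bsub>M\<^esub>x\<in>U. (v x + w x) \<odot>\<^bsub>M\<^esub> f x)"
      using U supp by (subst g[of U]) (auto simp: free_space_simps)
    also have "\<dots> = (\<Oplus>\<^bsub>M\<^esub>x\<in>U. v x \<odot>\<^bsub>M\<^esub> f x \<oplus>\<^bsub>M\<^esub> w x \<odot>\<^bsub>M\<^esub> f x)"
      using U f M.smult_l_distr M.smult_closed by (intro M.finsum_cong') (auto simp: Pi_iff)
    also have "\<dots> = g v \<oplus>\<^bsub>M\<^esub> g w"
      using U cl by (simp add: M.finsum_addf g[of U])
    finally show "g (v \<oplus>\<^bsub>free_space S\<^esub> w) = g v \<oplus>\<^bsub>M\<^esub> g w" .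
  qed
  have "g (basis_vector x) = f x" if "x \<in> S" for x
  proof -
    have "{y. basis_vector x y \<noteq> 0} \<subseteq> {x}"
      by (auto simp: basis_vector_def)
    then have "g (basis_vector x) = 1 \<odot>\<^bsub>M\<^esub> f x"
      using g[of "{x}" "basis_vector x"] that f M.smult_closed[of 1 "f x"]
      by (auto simp: basis_vector_def Pi_iff)
    then show ?thesis
      using M.smult_one[of "f x"] that f by auto
  qed
  with lin show ?thesis
    by (intro bexI[OF _ restrict_Lin[OF module_free_space]]) (auto simp: basis_vector_closed)
qed

lemma direct_sum_simps:
  "carrier (direct_sum I M) =
    {v \<in> (\<Pi>\<^sub>E i\<in>I. carrier (M i)). finite {i \<in> I. v i \<noteq> \<zero>\<^bsub>M i\<^esub>}}"
  "\<zero>\<^bsub>direct_sum I M\<^esub> = (\<lambda>i\<in>I. \<zero>\<^bsub>M i\<^esub>)"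
  "v \<oplus>\<^bsub>direct_sum I M\<^esub> w = (\<lambda>i\<in>I. v i \<oplus>\<^bsub>M i\<^esub> w i)"
  "c \<odot>\<^bsub>direct_sum I M\<^esub> v = (\<lambda>i\<in>I. c \<odot>\<^bsub>M i\<^esub> v i)"
  by (simp_all add: direct_sum_def)

context
  fixes I :: "'i set" and M :: "'i \<Rightarrow> (complex, 'v) module"
  assumes M: "\<And>i. i \<in> I \<Longrightarrow> module \<C> (M i)"
begin

lemma summand_rules:
  assumes "i \<in> I"
  shows "abelian_group (M i)" "x \<in> carrier (M i) \<Longrightarrow> c \<odot>\<^bsub>M i\<^esub> x \<in> carrier (M i)"
    "c \<odot>\<^bsub>M i\<^esub> \<zero>\<^bsub>M i\<^esub> = \<zero>\<^bsub>M i\<^esub>"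
    "x \<in> carrier (M i) \<Longrightarrow> 0 \<odot>\<^bsub>M i\<^esub> x = \<zero>\<^bsub>M i\<^esub>"
    "x \<in> carrier (M i) \<Longrightarrow> 1 \<odot>\<^bsub>M i\<^esub> x = x"
    "x \<in> carrier (M i) \<Longrightarrow> (a + b) \<odot>\<^bsub>M i\<^esub> x = a \<odot>\<^bsub>M i\<^esub> x \<oplus>\<^bsub>M i\<^esub> b \<odot>\<^bsub>M i\<^esub> x"
    "x \<in> carrier (M i) \<Longrightarrow> y \<in> carrier (M i) \<Longrightarrow>
      c \<odot>\<^bsub>M i\<^esub> (x \<oplus>\<^bsub>M i\<^esub> y) = c \<odot>\<^bsub>M i\<^esub> x \<oplus>\<^bsub>M i\<^esub> c \<odot>\<^bsub>M i\<^esub> y"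
    "x \<in> carrier (M i) \<Longrightarrow> (a * b) \<odot>\<^bsub>M i\<^esub> x = a \<odot>\<^bsub>M i\<^esub> (b \<odot>\<^bsub>M i\<^esub> x)"
proof -
  interpret module \<C> "M i" by (rule M[OF assms])
  show "abelian_group (M i)" by (rule M.abelian_group_axioms)
  show "x \<in> carrier (M i) \<Longrightarrow> c \<odot>\<^bsub>M i\<^esub> x \<in> carrier (M i)"
    "c \<odot>\<^bsub>M i\<^esub> \<zero>\<^bsub>M i\<^esub> = \<zero>\<^bsub>M i\<^esub>"
    "x \<in> carrier (M i) \<Longrightarrow> 0 \<odot>\<^bsub>M i\<^esub> x = \<zero>\<^bsub>M i\<^esub>"
    "x \<in> carrier (M i) \<Longrightarrow> 1 \<odot>\<^bsub>M i\<^esub> x = x"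
    "x \<in> carrier (M i) \<Longrightarrow> (a + b) \<odot>\<^bsub>M i\<^esub> x = a \<odot>\<^bsub>M i\<^esub> x \<oplus>\<^bsub>M i\<^esub> b \<odot>\<^bsub>M i\<^esub> x"
    "x \<in> carrier (M i) \<Longrightarrow> y \<in> carrier (M i) \<Longrightarrow>
      c \<odot>\<^bsub>M i\<^esub> (x \<oplus>\<^bsub>M i\<^esub> y) = c \<odot>\<^bsub>M i\<^esub> x \<oplus>\<^bsub>M i\<^esub> c \<odot>\<^bsub>M i\<^esub> y"
    "x \<in> carrier (M i) \<Longrightarrow> (a * b) \<odot>\<^bsub>M i\<^esub> x = a \<odot>\<^bsub>M i\<^esub> (b \<odot>\<^bsub>M i\<^esub> x)"
    using smult_closed[of c] smult_r_null[of c] smult_l_null smult_one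
      smult_l_distr[of a b] smult_r_distr[of c] smult_assoc1[of a b] by simp_all
qed

lemmas summand_monoid = abelian_group.axioms(1)[OF summand_rules(1)]

lemma module_direct_sum: "module \<C> (direct_sum I M)"
proof (rule module_complexI)
  fix v w
  assume v: "v \<in> carrier (direct_sum I M)" and w: "w \<in> carrier (direct_sum I M)"
  have "{i \<in> I. v i \<oplus>\<^bsub>M i\<^esub> w i \<noteq> \<zero>\<^bsub>M i\<^esub>} \<subseteq> {i \<in> I. v i \<noteq> \<zero>\<^bsub>M i\<^esub>} \<union> {i \<in> I. w i \<noteq> \<zero>\<^bsub>M i\<^esub>}"
    using abelian_monoid.l_zero[OF summand_monoid abelian_monoid.zero_closed[OF summand_monoid]] by auto
  moreover have "finite ({i \<in> I. v i \<noteq> \<zero>\<^bsub>M i\<^esub>} \<union> {i \<in> I. w i \<noteq> \<zero>\<^bsub>M i\<^esub>})"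
    using v w by (simp add: direct_sum_simps)
  ultimately have "finite {i \<in> I. v i \<oplus>\<^bsub>M i\<^esub> w i \<noteq> \<zero>\<^bsub>M i\<^esub>}"
    by (rule finite_subset)
  then show "v \<oplus>\<^bsub>direct_sum I M\<^esub> w \<in> carrier (direct_sum I M)"
    using v w by (auto simp: direct_sum_simps PiE_iff abelian_monoid.a_closed[OF summand_monoid] cong: conj_cong)
next
  fix v c
  assume v: "v \<in> carrier (direct_sum I M)"
  have "{i \<in> I. c \<odot>\<^bsub>M i\<^esub> v i \<noteq> \<zero>\<^bsub>M i\<^esub>} \<subseteq> {i \<in> I. v i \<noteq> \<zero>\<^bsub>M i\<^esub>}"
    using summand_rules(3) by auto
  moreover have "finite {i \<in> I. v i \<noteq> \<zero>\<^bsub>M i\<^esub>}"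
    using v by (simp add: direct_sum_simps)
  ultimately have "finite {i \<in> I. c \<odot>\<^bsub>M i\<^esub> v i \<noteq> \<zero>\<^bsub>M i\<^esub>}"
    by (rule finite_subset)
  then show "c \<odot>\<^bsub>direct_sum I M\<^esub> v \<in> carrier (direct_sum I M)"
    using v by (auto simp: direct_sum_simps PiE_iff summand_rules cong: conj_cong)
next
  fix v assume v: "v \<in> carrier (direct_sum I M)"
  have "(\<lambda>i\<in>I. \<zero>\<^bsub>M i\<^esub> \<oplus>\<^bsub>M i\<^esub> v i) = v" "(\<lambda>i\<in>I. 1 \<odot>\<^bsub>M i\<^esub> v i) = v"
    using v by (auto simp: direct_sum_simps PiE_iff summand_rules abelian_monoid.l_zero[OF summand_monoid]
        fun_eq_iff extensional_def)
  then show "\<zero>\<^bsub>direct_sum I M\<^esub> \<oplus>\<^bsub>direct_sum I M\<^esub> v = v" "1 \<odot>\<^bsub>direct_sum I M\<^esub> v = v"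
    by (simp_all add: direct_sum_simps cong: restrict_cong)
next
  fix u v w
  assume "u \<in> carrier (direct_sum I M)" "v \<in> carrier (direct_sum I M)" "w \<in> carrier (direct_sum I M)"
  then show "u \<oplus>\<^bsub>direct_sum I M\<^esub> v \<oplus>\<^bsub>direct_sum I M\<^esub> w =
      u \<oplus>\<^bsub>direct_sum I M\<^esub> (v \<oplus>\<^bsub>direct_sum I M\<^esub> w)"
    by (simp add: direct_sum_simps PiE_iff abelian_monoid.a_assoc[OF summand_monoid] cong: restrict_cong)
next
  fix v w
  assume "v \<in> carrier (direct_sum I M)" "w \<in> carrier (direct_sum I M)"
  then show "v \<oplus>\<^bsub>direct_sum I M\<^esub> w = w \<oplus>\<^bsub>direct_sum I M\<^esub> v"
    by (auto simp: direct_sum_simps PiE_iff intro!: restrict_ext abelian_monoid.a_comm[OF summand_monoid])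
qed (auto simp: direct_sum_simps PiE_iff summand_rules abelian_monoid.zero_closed[OF summand_monoid]
    abelian_monoid.a_closed[OF summand_monoid] intro!: restrict_ext cong: conj_cong)

lemma summand_inj_linear:
  assumes "i \<in> I"
  shows "linear_map (M i) (direct_sum I M) (summand_inj I M i)"
  by (rule linear_mapI)
    (auto simp: direct_sum_simps summand_inj_def PiE_iff summand_rules
      abelian_monoid.zero_closed[OF summand_monoid] abelian_monoid.l_zero[OF summand_monoid] intro!: restrict_ext intro: finite_subset[of _ "{i}"]
      split: if_splits)

lemma direct_sum_span:
  "subspace_span (direct_sum I M) (\<Union>i\<in>I. summand_inj I M i ` carrier (M i)) =
    carrier (direct_sum I M)" (is "subspace_span _ ?G = _")
proof
  interpret F: module \<C> "direct_sum I M" by (rule module_direct_sum)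
  have G: "?G \<subseteq> carrier (direct_sum I M)"
    by (auto intro: linear_map_closed[OF summand_inj_linear])
  show "subspace_span (direct_sum I M) ?G \<subseteq> carrier (direct_sum I M)"
    by (intro subspace_span_least F.carrier_is_submodule G)
  let ?W = "subspace_span (direct_sum I M) ?G"
  have W: "submodule ?W \<C> (direct_sum I M)"
    by (rule submodule_subspace_span[OF module_direct_sum G])
  have "v \<in> ?W" if "finite U" "U \<subseteq> I" "v \<in> (\<Pi>\<^sub>E i\<in>I. carrier (M i))"
    "{i \<in> I. v i \<noteq> \<zero>\<^bsub>M i\<^esub>} \<subseteq> U" for U and v
    using that
  proof (induction U arbitrary: v)
    case empty
    then have "v = \<zero>\<^bsub>direct_sum I M\<^esub>"
      by (auto simp: direct_sum_simps fun_eq_iff PiE_iff extensional_def)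
    then show ?case
      using subgroup.one_closed[OF submodule.axioms(1)[OF W]] by simp
  next
    case (insert u U)
    have u: "u \<in> I" using insert.prems by auto
    let ?v' = "v(u := \<zero>\<^bsub>M u\<^esub>)"
    have "?v' \<in> ?W"
      using insert.prems u by (intro insert.IH) (auto simp: PiE_iff extensional_def
          abelian_monoid.zero_closed[OF summand_monoid])
    moreover have "summand_inj I M u (v u) \<in> ?W"
      using insert.prems u subspace_span_superset[of ?G "direct_sum I M"] by blast
    ultimately have "?v' \<oplus>\<^bsub>direct_sum I M\<^esub> summand_inj I M u (v u) \<in> ?W"
      by (rule F.submoduleE(5)[OF W])
    moreover have "?v' \<oplus>\<^bsub>direct_sum I M\<^esub> summand_inj I M u (v u) = v"
      using insert.prems(2) u by (auto simp: direct_sum_simps summand_inj_def fun_eq_iff PiE_iff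
          extensional_def abelian_monoid.l_zero[OF summand_monoid] abelian_monoid.r_zero[OF summand_monoid])
    ultimately show ?case by simp
  qed
  from this[of "{i \<in> I. v i \<noteq> \<zero>\<^bsub>M i\<^esub>}" v for v]
  show "carrier (direct_sum I M) \<subseteq> ?W"
    by (auto simp: direct_sum_simps)
qed

lemma direct_sum_eqI:
  assumes "module \<C> M'" "linear_map (direct_sum I M) M' f" "linear_map (direct_sum I M) M' g"
    and "\<And>i x. i \<in> I \<Longrightarrow> x \<in> carrier (M i) \<Longrightarrow> f (summand_inj I M i x) = g (summand_inj I M i x)"
    and "v \<in> carrier (direct_sum I M)"
  shows "f v = g v"
  by (rule linear_maps_eq_on_span[OF module_direct_sum assms(1-3) direct_sum_span _ assms(5)])
    (use assms(4) in auto)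

lemma direct_sum_lift:
  assumes M': "module \<C> M'" and f: "\<And>i. i \<in> I \<Longrightarrow> linear_map (M i) M' (f i)"
  shows "\<exists>g\<in>Lin (direct_sum I M) M'. \<forall>i\<in>I. \<forall>x\<in>carrier (M i). g (summand_inj I M i x) = f i x"
proof -
  interpret M': module \<C> M' by fact
  define g where "g v = (\<Oplus>\<^bsub>M'\<^esub>i\<in>{i \<in> I. v i \<noteq> \<zero>\<^bsub>M i\<^esub>}. f i (v i))" for v
  have f0: "f i \<zero>\<^bsub>M i\<^esub> = \<zero>\<^bsub>M'\<^esub>" if "i \<in> I" for i
    by (rule linear_map_zero[OF M[OF that] M' f[OF that]])
  have cl: "(\<lambda>i. f i (v i)) \<in> U \<rightarrow> carrier M'"
    if "U \<subseteq> I" "\<And>i. i \<in> I \<Longrightarrow> v i \<in> carrier (M i)" for U v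
    using that by (auto intro!: linear_map_closed[OF f])
  have g: "g v = (\<Oplus>\<^bsub>M'\<^esub>i\<in>U. f i (v i))"
    if "finite U" "U \<subseteq> I" "{i \<in> I. v i \<noteq> \<zero>\<^bsub>M i\<^esub>} \<subseteq> U" "\<And>i. i \<in> I \<Longrightarrow> v i \<in> carrier (M i)" for U v
    unfolding g_def using that cl[OF that(2,4)] f0
    by (intro M'.add.finprod_mono_neutral_cong_left) (auto simp: Pi_iff subset_iff)
  have lin: "linear_map (direct_sum I M) M' g"
  proof (rule linear_mapI)
    fix v w c
    assume v: "v \<in> carrier (direct_sum I M)"
    let ?V = "{i \<in> I. v i \<noteq> \<zero>\<^bsub>M i\<^esub>}"
    have V: "finite ?V" "?V \<subseteq> I" "\<And>i. i \<in> I \<Longrightarrow> v i \<in> carrier (M i)"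
      using v by (auto simp: direct_sum_simps)
    show "g v \<in> carrier M'"
      unfolding g_def using V by (intro M'.finsum_closed cl) auto
    have "g (c \<odot>\<^bsub>direct_sum I M\<^esub> v) = (\<Oplus>\<^bsub>M'\<^esub>i\<in>?V. f i (c \<odot>\<^bsub>M i\<^esub> v i))"
      using V by (subst g[of ?V]) (auto simp: direct_sum_simps summand_rules intro!: M'.finsum_cong'
          linear_map_closed[OF f])
    also have "\<dots> = (\<Oplus>\<^bsub>M'\<^esub>i\<in>?V. c \<odot>\<^bsub>M'\<^esub> f i (v i))"
      using V by (intro M'.finsum_cong')
        (auto simp: linear_map_smult[OF f] intro!: M'.smult_closed linear_map_closed[OF f])
    also have "\<dots> = c \<odot>\<^bsub>M'\<^esub> g v"
      unfolding g_def using V cl[of ?V v] by (subst M'.finsum_smult_ldistr) auto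
    finally show "g (c \<odot>\<^bsub>direct_sum I M\<^esub> v) = c \<odot>\<^bsub>M'\<^esub> g v" .
    assume w: "w \<in> carrier (direct_sum I M)"
    then have W: "\<And>i. i \<in> I \<Longrightarrow> w i \<in> carrier (M i)"
      by (auto simp: direct_sum_simps)
    obtain U where U: "finite U" "U \<subseteq> I" "?V \<subseteq> U" "{i \<in> I. w i \<noteq> \<zero>\<^bsub>M i\<^esub>} \<subseteq> U"
    proof (rule that)
      show "finite (?V \<union> {i \<in> I. w i \<noteq> \<zero>\<^bsub>M i\<^esub>})"
        using V w by (simp add: direct_sum_simps)
    qed auto
    have supp: "{i \<in> I. v i \<oplus>\<^bsub>M i\<^esub> w i \<noteq> \<zero>\<^bsub>M i\<^esub>} \<subseteq> U"
      using U(3,4) abelian_monoid.l_zero[OF summand_monoid abelian_monoid.zero_closed[OF summand_monoid]] by fastforce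
    have "g (v \<oplus>\<^bsub>direct_sum I M\<^esub> w) = (\<Oplus>\<^bsub>M'\<^esub>i\<in>U. f i ((v \<oplus>\<^bsub>direct_sum I M\<^esub> w) i))"
      using U V W supp by (intro g) (auto simp: direct_sum_simps abelian_monoid.a_closed[OF summand_monoid])
    also have "\<dots> = (\<Oplus>\<^bsub>M'\<^esub>i\<in>U. f i (v i) \<oplus>\<^bsub>M'\<^esub> f i (w i))"
    proof (intro M'.finsum_cong' refl Pi_I)
      fix i assume "i \<in> U"
      then have i: "i \<in> I" using U(2) by auto
      show "f i (v i) \<oplus>\<^bsub>M'\<^esub> f i (w i) \<in> carrier M'"
        using i V(3) W by (intro M'.a_closed linear_map_closed[OF f])
      show "f i ((v \<oplus>\<^bsub>direct_sum I M\<^esub> w) i) = f i (v i) \<oplus>\<^bsub>M'\<^esub> f i (w i)"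
        using i V(3) W linear_map_add[OF f[OF i]] by (simp add: direct_sum_simps)
    qed
    also have "\<dots> = g v \<oplus>\<^bsub>M'\<^esub> g w"
      using g[OF U(1-3) V(3)] g[OF U(1,2,4) W] M'.finsum_addf[OF cl[OF U(2) V(3)] cl[OF U(2) W]]
      by simp
    finally show "g (v \<oplus>\<^bsub>direct_sum I M\<^esub> w) = g v \<oplus>\<^bsub>M'\<^esub> g w" .
  qed
  have "g (summand_inj I M i x) = f i x" if "i \<in> I" "x \<in> carrier (M i)" for i x
  proof -
    have "summand_inj I M i x j \<in> carrier (M j)" if "j \<in> I" for j
      using that \<open>x \<in> carrier (M i)\<close>
      by (auto simp: summand_inj_def abelian_monoid.zero_closed[OF summand_monoid])
    moreover have "{j \<in> I. summand_inj I M i x j \<noteq> \<zero>\<^bsub>M j\<^esub>} \<subseteq> {i}"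
      by (auto simp: summand_inj_def)
    ultimately have "g (summand_inj I M i x) = f i (summand_inj I M i x i)"
      using g[of "{i}" "summand_inj I M i x"] that linear_map_closed[OF f[OF that(1)] that(2)]
      by (simp add: summand_inj_def)
    then show ?thesis
      using that by (simp add: summand_inj_def)
  qed
  with lin show ?thesis
    by (intro bexI[OF _ restrict_Lin[OF module_direct_sum]])
      (auto simp: linear_map_closed[OF summand_inj_linear])
qed

end


section \<open>Multilinear maps and tensor powers\<close>

text \<open>Regrouping a finite sum along the fibres of a map, and reindexing along a bijection.\<close>

lemma (in abelian_monoid) finsum_fibres:
  assumes "finite S" "finite T" "h \<in> S \<rightarrow> T" "g \<in> S \<rightarrow> carrier G"
  shows "(\<Oplus>x\<in>S. g x) = (\<Oplus>y\<in>T. \<Oplus>x\<in>{x \<in> S. h x = y}. g x)"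
proof -
  have "S = (\<Union>y\<in>T. {x \<in> S. h x = y})"
    using assms(3) by auto
  moreover have "(\<Oplus>x\<in>(\<Union>y\<in>T. {x \<in> S. h x = y}). g x) = (\<Oplus>y\<in>T. \<Oplus>x\<in>{x \<in> S. h x = y}. g x)"
    by (rule add.finprod_UN_disjoint) (use assms in \<open>auto simp: pairwise_def disjnt_def\<close>)
  ultimately show ?thesis by simp
qed

lemma (in abelian_monoid) finsum_bij:
  assumes "bij_betw h S T" "g \<in> T \<rightarrow> carrier G"
  shows "(\<Oplus>t\<in>T. g t) = (\<Oplus>s\<in>S. g (h s))"
  using finsum_reindex[of g h S] assms by (simp add: bij_betw_def)

text \<open>
  A function of the \<open>n + 1\<close> vectors of a tuple is multilinear if it is linear in each of
  them; the \<open>i\<close>-th argument is varied by updating the tuple at \<open>i\<close>.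
\<close>

definition multilinear ::
  "(complex, 'a) module \<Rightarrow> nat \<Rightarrow> (complex, 'v) module \<Rightarrow> ((nat \<Rightarrow> 'a) \<Rightarrow> 'v) \<Rightarrow> bool"
  where "multilinear A n M F \<longleftrightarrow>
    (\<forall>a\<in>tuples A n. F a \<in> carrier M) \<and>
    (\<forall>a\<in>tuples A n. \<forall>i\<in>{0..n}. linear_map A M (\<lambda>x. F (a(i := x))))"

lemma tuples_update: "a \<in> tuples A n \<Longrightarrow> i \<in> {0..n} \<Longrightarrow> x \<in> carrier A \<Longrightarrow> a(i := x) \<in> tuples A n"
  by (auto simp: tuples_def PiE_iff extensional_def)

lemma multilinear_closed: "multilinear A n M F \<Longrightarrow> a \<in> tuples A n \<Longrightarrow> F a \<in> carrier M"
  and multilinear_linear: "multilinear A n M F \<Longrightarrow> a \<in> tuples A n \<Longrightarrow> i \<in> {0..n} \<Longrightarrow>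
    linear_map A M (\<lambda>x. F (a(i := x)))"
  by (simp_all add: multilinear_def)

lemma multilinear_sum:
  assumes "module \<C> A" "module \<C> M" "\<And>p. p \<in> P \<Longrightarrow> multilinear A n M (F p)"
  shows "multilinear A n M (\<lambda>a. \<Oplus>\<^bsub>M\<^esub>p\<in>P. F p a)"
proof -
  interpret M: module \<C> M by fact
  show ?thesis
    unfolding multilinear_def
    by (intro conjI ballI M.finsum_closed Pi_I linear_map_sum[OF assms(1,2)]
        multilinear_closed[OF assms(3)] multilinear_linear[OF assms(3)])
qed

lemma multilinear_precompose:
  assumes A: "module \<C> A" and F: "multilinear A n M F"
    and h: "\<And>i. i \<in> {0..n} \<Longrightarrow> linear_map A A (h i)"
  shows "multilinear A n M (\<lambda>a. F (\<lambda>i\<in>{0..n}. h i (a i)))"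
proof -
  have t: "(\<lambda>i\<in>{0..n}. h i (a i)) \<in> tuples A n" if "a \<in> tuples A n" for a
    using that by (auto simp: tuples_def intro!: linear_map_closed[OF h])
  have "linear_map A M (\<lambda>x. F (\<lambda>j\<in>{0..n}. h j ((a(i := x)) j)))"
    if a: "a \<in> tuples A n" and i: "i \<in> {0..n}" for a i
  proof -
    have "(\<lambda>j\<in>{0..n}. h j ((a(i := x)) j)) = (\<lambda>j\<in>{0..n}. h j (a j))(i := h i x)" for x
      using i by auto
    then show ?thesis
      using linear_map_compose[OF h[OF i] multilinear_linear[OF F t[OF a] i]] by simp
  qed
  then show ?thesis
    using multilinear_closed[OF F t] by (simp add: multilinear_def)
qed

text \<open>A multilinear function of sums is the sum over all choices of one summand in each argument.\<close>

lemma multilinear_expand: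
  assumes A: "module \<C> A" and M: "module \<C> M" and F: "multilinear A n M F"
    and fin: "\<And>j. j \<in> {0..n} \<Longrightarrow> finite (S j)"
    and g: "\<And>j s. j \<in> {0..n} \<Longrightarrow> s \<in> S j \<Longrightarrow> g j s \<in> carrier A"
  shows "F (\<lambda>j\<in>{0..n}. \<Oplus>\<^bsub>A\<^esub>s\<in>S j. g j s) =
    (\<Oplus>\<^bsub>M\<^esub>f\<in>(\<Pi>\<^sub>E j\<in>{0..n}. S j). F (\<lambda>j\<in>{0..n}. g j (f j)))"
proof -
  interpret A: module \<C> A by fact
  interpret M: module \<C> M by fact
  \<comment> \<open>Induction on the set \<open>U\<close> of arguments that are sums; the others are single vectors \<open>a j\<close>.\<close>
  have "F (\<lambda>j\<in>{0..n}. if j \<in> U then (\<Oplus>\<^bsub>A\<^esub>s\<in>S j. g j s) else a j) =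
      (\<Oplus>\<^bsub>M\<^esub>f\<in>(\<Pi>\<^sub>E j\<in>U. S j). F (\<lambda>j\<in>{0..n}. if j \<in> U then g j (f j) else a j))"
    if "finite U" "U \<subseteq> {0..n}" "a \<in> tuples A n" for U a
    using that
  proof (induction U arbitrary: a)
    case empty
    have "(\<lambda>j\<in>{0..n}. a j) = a"
      using empty.prems(2) by (auto simp: tuples_def PiE_iff extensional_def)
    then show ?case
      using multilinear_closed[OF F empty.prems(2)] by (simp add: M.finsum_insert)
  next
    case (insert u U)
    let ?s = "\<Oplus>\<^bsub>A\<^esub>s\<in>S u. g u s"
    have u: "u \<in> {0..n}" and U: "finite U" "U \<subseteq> {0..n}" "u \<notin> U"
      using insert by auto
    have s: "?s \<in> carrier A"
      using g[OF u] by (intro A.finsum_closed) auto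
    define t where "t f = (\<lambda>j\<in>{0..n}. if j \<in> U then g j (f j) else a j)" for f
    have t: "t f \<in> tuples A n" if "f \<in> (\<Pi>\<^sub>E j\<in>U. S j)" for f
      using that insert.prems(2) U g by (fastforce simp: t_def tuples_def PiE_iff)
    have "F (\<lambda>j\<in>{0..n}. if j \<in> insert u U then (\<Oplus>\<^bsub>A\<^esub>s\<in>S j. g j s) else a j) =
        F (\<lambda>j\<in>{0..n}. if j \<in> U then (\<Oplus>\<^bsub>A\<^esub>s\<in>S j. g j s) else (a(u := ?s)) j)"
      by (intro arg_cong[of _ _ F] restrict_ext) (use U in auto)
    also have "\<dots> = (\<Oplus>\<^bsub>M\<^esub>f\<in>(\<Pi>\<^sub>E j\<in>U. S j). F (\<lambda>j\<in>{0..n}. if j \<in> U then g j (f j) else (a(u := ?s)) j))"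
      by (rule insert.IH[OF U(2) tuples_update[OF insert.prems(2) u s]])
    also have "\<dots> = (\<Oplus>\<^bsub>M\<^esub>f\<in>(\<Pi>\<^sub>E j\<in>U. S j). \<Oplus>\<^bsub>M\<^esub>s\<in>S u. F ((t f)(u := g u s)))"
    proof (intro M.finsum_cong' refl Pi_I)
      fix f assume f: "f \<in> (\<Pi>\<^sub>E j\<in>U. S j)"
      show "(\<Oplus>\<^bsub>M\<^esub>s\<in>S u. F ((t f)(u := g u s))) \<in> carrier M"
        using g[OF u] by (intro M.finsum_closed) (auto intro!: multilinear_closed[OF F] tuples_update t f u)
      have "(\<lambda>j\<in>{0..n}. if j \<in> U then g j (f j) else (a(u := ?s)) j) = (t f)(u := ?s)"
        using u U by (auto simp: t_def)
      then show "F (\<lambda>j\<in>{0..n}. if j \<in> U then g j (f j) else (a(u := ?s)) j) =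
          (\<Oplus>\<^bsub>M\<^esub>s\<in>S u. F ((t f)(u := g u s)))"
        using linear_map_finsum[OF A M multilinear_linear[OF F t[OF f] u], of "g u" "S u"] g[OF u]
        by auto
    qed
    also have "\<dots> = (\<Oplus>\<^bsub>M\<^esub>f\<in>(\<Pi>\<^sub>E j\<in>insert u U. S j).
        F (\<lambda>j\<in>{0..n}. if j \<in> insert u U then g j (f j) else a j))"
    proof -
      let ?X = "\<Pi>\<^sub>E j\<in>insert u U. S j" and ?Y = "\<Pi>\<^sub>E j\<in>U. S j"
      let ?G = "\<lambda>f. F (\<lambda>j\<in>{0..n}. if j \<in> insert u U then g j (f j) else a j)"
      have X: "finite ?X" "finite ?Y"
        using U insert.prems(1) fin by (auto intro!: finite_PiE)
      have G: "?G \<in> ?X \<rightarrow> carrier M"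
        using g insert.prems
        by (intro Pi_I multilinear_closed[OF F]) (fastforce simp: tuples_def PiE_iff)
      have "(\<Oplus>\<^bsub>M\<^esub>f\<in>?X. ?G f) = (\<Oplus>\<^bsub>M\<^esub>f0\<in>?Y. \<Oplus>\<^bsub>M\<^esub>f\<in>{f \<in> ?X. restrict f U = f0}. ?G f)"
        by (rule M.finsum_fibres[OF X _ G]) auto
      also have "\<dots> = (\<Oplus>\<^bsub>M\<^esub>f\<in>?Y. \<Oplus>\<^bsub>M\<^esub>s\<in>S u. F ((t f)(u := g u s)))"
      proof (intro M.finsum_cong' refl Pi_I)
        fix f assume f: "f \<in> ?Y"
        show "(\<Oplus>\<^bsub>M\<^esub>s\<in>S u. F ((t f)(u := g u s))) \<in> carrier M"
          using g[OF u] by (intro M.finsum_closed) (auto intro!: multilinear_closed[OF F] tuples_update t f u)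
        have "bij_betw (\<lambda>s. f(u := s)) (S u) {f' \<in> ?X. restrict f' U = f}"
        proof (rule bij_betwI[where g = "\<lambda>f'. f' u"])
          fix f' assume f': "f' \<in> {f' \<in> ?X. restrict f' U = f}"
          have "(f(u := f' u)) j = f' j" for j
            using f' by (cases "j = u"; cases "j \<in> U") (auto simp: PiE_iff extensional_def)
          then show "f(u := f' u) = f'" ..
        qed (use f U in \<open>auto simp: PiE_iff extensional_def fun_eq_iff\<close>)
        then have "(\<Oplus>\<^bsub>M\<^esub>f'\<in>{f' \<in> ?X. restrict f' U = f}. ?G f') = (\<Oplus>\<^bsub>M\<^esub>s\<in>S u. ?G (f(u := s)))"
          by (rule M.finsum_bij) (use G in auto)
        also have "\<dots> = (\<Oplus>\<^bsub>M\<^esub>s\<in>S u. F ((t f)(u := g u s)))"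
        proof (intro M.finsum_cong' refl Pi_I)
          fix s assume "s \<in> S u"
          show "F ((t f)(u := g u s)) \<in> carrier M"
            using g[OF u] \<open>s \<in> S u\<close> by (auto intro!: multilinear_closed[OF F] tuples_update t f u)
          show "?G (f(u := s)) = F ((t f)(u := g u s))"
            using u U by (intro arg_cong[of _ _ F]) (auto simp: t_def)
        qed
        finally show "(\<Oplus>\<^bsub>M\<^esub>f'\<in>{f' \<in> ?X. restrict f' U = f}. ?G f') =
          (\<Oplus>\<^bsub>M\<^esub>s\<in>S u. F ((t f)(u := g u s)))" .
      qed
      finally show ?thesis by simp
    qed
    finally show ?case .
  qed
  from this[of "{0..n}" "\<lambda>j\<in>{0..n}. \<zero>\<^bsub>A\<^esub>"] show ?thesis
    by (simp add: tuples_def cong: restrict_cong)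
qed


text \<open>The free space on tuples, of which \<^const>\<open>tensor_power\<close> is a quotient.\<close>

abbreviation free_tensors :: "(complex, 'a) module \<Rightarrow> nat \<Rightarrow> (complex, (nat \<Rightarrow> 'a) \<Rightarrow> complex) module"
  where "free_tensors A n \<equiv> free_space (tuples A n)"

context
  fixes A :: "(complex, 'a) module"
  assumes A: "module \<C> A"
begin

interpretation A: module \<C> A by (rule A)

lemma tensor_relations_closed: "tensor_relations A n \<subseteq> carrier (free_tensors A n)"
proof -
  interpret F: module \<C> "free_tensors A n" by (rule module_free_space)
  show ?thesis
    unfolding tensor_relations_def
    by (auto intro!: F.minus_closed F.a_closed F.smult_closed basis_vector_closed tuples_update
        A.smult_closed A.a_closed)
qed

lemma submodule_tensor_relation_space: "submodule (tensor_relation_space A n) \<C> (free_tensors A n)"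
  unfolding tensor_relation_space_def
  by (rule submodule_subspace_span[OF module_free_space tensor_relations_closed])

lemma module_tensor_power: "module \<C> (tensor_power A n)"
  unfolding tensor_power_def by (rule module_quotient[OF module_free_space submodule_tensor_relation_space])

lemma tensor_power_span:
  "subspace_span (tensor_power A n) (pure_tensor A n ` tuples A n) = carrier (tensor_power A n)"
proof -
  have "subspace_span (tensor_power A n)
      ((\<lambda>x. tensor_relation_space A n +>\<^bsub>free_tensors A n\<^esub> x) ` (basis_vector ` tuples A n)) =
      carrier (tensor_power A n)"
    unfolding tensor_power_def
    by (rule subspace_span_surj_image[OF module_free_space
          module_quotient[OF module_free_space submodule_tensor_relation_space]
          quotient_linear_map[OF module_free_space submodule_tensor_relation_space]
          quotient_surj[OF module_free_space submodule_tensor_relation_space, symmetric]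
          free_space_span])
  then show ?thesis
    by (simp add: image_image pure_tensor_def[abs_def])
qed

lemma tensor_power_eqI:
  assumes "module \<C> M" "linear_map (tensor_power A n) M f" "linear_map (tensor_power A n) M g"
    and "\<And>a. a \<in> tuples A n \<Longrightarrow> f (pure_tensor A n a) = g (pure_tensor A n a)"
    and "x \<in> carrier (tensor_power A n)"
  shows "f x = g x"
  by (rule linear_maps_eq_on_span[OF module_tensor_power assms(1-3) tensor_power_span _ assms(5)])
    (use assms(4) in auto)

lemma multilinear_pure_tensor: "multilinear A n (tensor_power A n) (pure_tensor A n)"
proof -
  interpret F: module \<C> "free_tensors A n" by (rule module_free_space)
  let ?W = "tensor_relation_space A n"
  note p = quotient_linear_map[OF module_free_space submodule_tensor_relation_space[of n],
      folded tensor_power_def]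
  have rel: "r \<in> ?W" if "r \<in> tensor_relations A n" for r
    unfolding tensor_relation_space_def by (rule subsetD[OF subspace_span_superset that])
  note eq = iffD2[OF quotient_eq_iff[OF module_free_space submodule_tensor_relation_space]]
  have cl: "pure_tensor A n a \<in> carrier (tensor_power A n)" if "a \<in> tuples A n" for a
    unfolding pure_tensor_def by (rule linear_map_closed[OF p basis_vector_closed[OF that]])
  have "linear_map A (tensor_power A n) (\<lambda>x. pure_tensor A n (a(i := x)))"
    if a: "a \<in> tuples A n" and i: "i \<in> {0..n}" for a i
  proof (rule linear_mapI)
    fix c x y assume x: "x \<in> carrier A"
    have bx: "basis_vector (a(i := x)) \<in> carrier (free_tensors A n)"
      by (intro basis_vector_closed tuples_update a i x)
    show "pure_tensor A n (a(i := x)) \<in> carrier (tensor_power A n)"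
      by (intro cl tuples_update a i x)
    have "basis_vector (a(i := c \<odot>\<^bsub>A\<^esub> x)) \<ominus>\<^bsub>free_tensors A n\<^esub>
        (c \<odot>\<^bsub>free_tensors A n\<^esub> basis_vector (a(i := x))) \<in> ?W"
      using a i x by (intro rel) (auto simp: tensor_relations_def)
    then have "pure_tensor A n (a(i := c \<odot>\<^bsub>A\<^esub> x)) =
        ?W +>\<^bsub>free_tensors A n\<^esub> (c \<odot>\<^bsub>free_tensors A n\<^esub> basis_vector (a(i := x)))"
      unfolding pure_tensor_def using a i x
      by (intro eq) (auto intro!: F.smult_closed basis_vector_closed tuples_update A.smult_closed)
    then show "pure_tensor A n (a(i := c \<odot>\<^bsub>A\<^esub> x)) = c \<odot>\<^bsub>tensor_power A n\<^esub> pure_tensor A n (a(i := x))"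
      using linear_map_smult[OF p bx] by (simp add: pure_tensor_def)
    assume y: "y \<in> carrier A"
    have "by": "basis_vector (a(i := y)) \<in> carrier (free_tensors A n)"
      by (intro basis_vector_closed tuples_update a i y)
    have "basis_vector (a(i := x \<oplus>\<^bsub>A\<^esub> y)) \<ominus>\<^bsub>free_tensors A n\<^esub>
        (basis_vector (a(i := x)) \<oplus>\<^bsub>free_tensors A n\<^esub> basis_vector (a(i := y))) \<in> ?W"
      using a i x y by (intro rel) (auto simp: tensor_relations_def)
    then have "pure_tensor A n (a(i := x \<oplus>\<^bsub>A\<^esub> y)) =
        ?W +>\<^bsub>free_tensors A n\<^esub> (basis_vector (a(i := x)) \<oplus>\<^bsub>free_tensors A n\<^esub> basis_vector (a(i := y)))"
      unfolding pure_tensor_def using a i x y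
      by (intro eq) (auto intro!: F.a_closed basis_vector_closed tuples_update A.a_closed)
    then show "pure_tensor A n (a(i := x \<oplus>\<^bsub>A\<^esub> y)) =
        pure_tensor A n (a(i := x)) \<oplus>\<^bsub>tensor_power A n\<^esub> pure_tensor A n (a(i := y))"
      using linear_map_add[OF p bx "by"] by (simp add: pure_tensor_def)
  qed
  with cl show ?thesis
    by (simp add: multilinear_def)
qed

lemma pure_tensor_closed: "a \<in> tuples A n \<Longrightarrow> pure_tensor A n a \<in> carrier (tensor_power A n)"
  by (rule multilinear_closed[OF multilinear_pure_tensor])

text \<open>
  The universal property of the tensor power, which makes \<^const>\<open>tensor_lift\<close> well defined: on the
  free space a multilinear \<open>F\<close> extends linearly, and the extension kills the tensor relations.
\<close>

lemma tensor_lift: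
  assumes M: "module \<C> M" and F: "multilinear A n M F"
  shows tensor_lift_Lin: "tensor_lift A n M F \<in> Lin (tensor_power A n) M" (is ?L)
    and tensor_lift_pure: "\<And>a. a \<in> tuples A n \<Longrightarrow> tensor_lift A n M F (pure_tensor A n a) = F a"
proof -
  interpret M: module \<C> M by fact
  interpret free: module \<C> "free_tensors A n" by (rule module_free_space)
  let ?P = "\<lambda>f. f \<in> Lin (tensor_power A n) M \<and> (\<forall>a\<in>tuples A n. f (pure_tensor A n a) = F a)"
  obtain g where g: "linear_map (free_tensors A n) M g" "\<And>a. a \<in> tuples A n \<Longrightarrow> g (basis_vector a) = F a"
    using free_space_lift[OF M, of F "tuples A n"] multilinear_closed[OF F] by (auto dest: Lin_linear)
  have "g r = \<zero>\<^bsub>M\<^esub>" if "r \<in> tensor_relations A n" for r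
    using that unfolding tensor_relations_def
  proof (elim UnE CollectE exE conjE, goal_cases)
    case (1 a i x y)
    note l = multilinear_linear[OF F 1(2,3)]
    show ?case
      using 1 linear_map_add[OF l 1(4,5)] linear_map_closed[OF l]
      by (simp add: linear_map_minus[OF module_free_space M g(1)] linear_map_add[OF g(1)] g(2)
          basis_vector_closed tuples_update M.minus_eq M.r_neg)
  next
    case (2 a i c x)
    note l = multilinear_linear[OF F 2(2,3)]
    show ?case
      using 2 linear_map_smult[OF l 2(4)] linear_map_closed[OF l]
      by (simp add: linear_map_minus[OF module_free_space M g(1)] linear_map_smult[OF g(1)] g(2)
          basis_vector_closed tuples_update M.minus_eq M.r_neg A.smult_closed free.smult_closed
          M.smult_closed)
  qed
  then have "g r = \<zero>\<^bsub>M\<^esub>" if "r \<in> tensor_relation_space A n" for r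
    using linear_map_zero_on_span[OF module_free_space M g(1) tensor_relations_closed] that
    unfolding tensor_relation_space_def by blast
  then obtain f where f: "f \<in> Lin (tensor_power A n) M"
      "\<And>x. x \<in> carrier (free_tensors A n) \<Longrightarrow> f (tensor_relation_space A n +>\<^bsub>free_tensors A n\<^esub> x) = g x"
    using quotient_factor[OF module_free_space submodule_tensor_relation_space M g(1)]
    unfolding tensor_power_def by blast
  have f_P: "?P f"
    using f g(2) by (simp add: pure_tensor_def basis_vector_closed)
  have "h = f" if "?P h" for h
    by (rule Lin_eqI, use that f in blast, use f in blast)
      (rule tensor_power_eqI[OF M], use that f_P in \<open>auto dest: Lin_linear\<close>)
  then have "?P (tensor_lift A n M F)"
    unfolding tensor_lift_def using f_P by (intro theI[of ?P]) auto
  then show ?L "\<And>a. a \<in> tuples A n \<Longrightarrow> tensor_lift A n M F (pure_tensor A n a) = F a"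
    by auto
qed

end


section \<open>The Loday functor\<close>

lemma Gamma_map_image: "\<phi> \<in> pointed_maps (Gamma_obj m) (Gamma_obj n) \<Longrightarrow> i \<in> {0..m} \<Longrightarrow> \<phi> i \<in> {0..n}"
  by (auto simp: pointed_maps_def Gamma_obj_def)

lemma pointed_maps_compose:
  assumes "\<alpha> \<in> pointed_maps S T" "\<beta> \<in> pointed_maps T U" "snd S \<in> fst S"
  shows "compose (fst S) \<beta> \<alpha> \<in> pointed_maps S U"
  using assms by (auto simp: pointed_maps_def PiE_iff compose_def)

lemma Gamma_pointed_maps_compose:
  assumes "\<phi> \<in> pointed_maps (Gamma_obj m) T" "\<beta> \<in> pointed_maps T U"
  shows "compose {0..m} \<beta> \<phi> \<in> pointed_maps (Gamma_obj m) U"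
  using pointed_maps_compose[OF assms] by (simp add: Gamma_obj_def)

lemma Gamma_over_iff: "(m, \<phi>) \<in> Gamma_over T \<longleftrightarrow> \<phi> \<in> pointed_maps (Gamma_obj m) T"
  by (simp add: Gamma_over_def)

text \<open>The differences that the colimit \<^const>\<open>Loday\<close> identifies with zero.\<close>

definition Loday_relations ::
  "(complex, 'a) module \<Rightarrow> 't set \<times> 't \<Rightarrow>
   (nat \<times> (nat \<Rightarrow> 't) \<Rightarrow> ((nat \<Rightarrow> 'a) \<Rightarrow> complex) set) set"
  where "Loday_relations A T =
    {Loday_sum_inj A T (m, compose {0..m} \<psi> \<alpha>) x \<ominus>\<^bsub>Loday_sum A T\<^esub>
       Loday_sum_inj A T (n, \<psi>) (Loday_Gamma_map A m n \<alpha> x)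
      | m n \<alpha> \<psi> x. \<alpha> \<in> pointed_maps (Gamma_obj m) (Gamma_obj n) \<and>
          \<psi> \<in> pointed_maps (Gamma_obj n) T \<and> x \<in> carrier (tensor_power A m)}"

lemma Loday_relation_space_eq:
  "Loday_relation_space A T = subspace_span (Loday_sum A T) (Loday_relations A T)"
  by (simp add: Loday_relation_space_def Loday_relations_def)

lemma compose_compose:
  "\<alpha> ` S \<subseteq> T \<Longrightarrow> compose S h (compose S g \<alpha>) = compose S (compose T h g) \<alpha>"
  by (auto simp: compose_def fun_eq_iff)

context
  fixes A :: "(complex, 'a) module"
  assumes algebra: "algebra \<C> A"
begin

interpretation A: algebra \<C> A by (rule algebra)

lemma module_A: "module \<C> A"
  by (rule A.module_axioms)

lemma fibre_product_tuple:
  assumes "a \<in> tuples A m"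
  shows "(\<lambda>j\<in>{0..n}. \<Otimes>\<^bsub>A\<^esub>i\<in>{i \<in> {0..m}. \<phi> i = j}. a i) \<in> tuples A n"
  using assms by (auto simp: tuples_def PiE_iff intro!: A.finprod_closed)

text \<open>
  Only the factor at \<open>\<phi> i\<close> depends on the \<open>i\<close>-th argument, and it is that argument times a
  product \<open>r\<close> not involving it.
\<close>

lemma multilinear_Gamma_map:
  assumes \<phi>: "\<phi> \<in> pointed_maps (Gamma_obj m) (Gamma_obj n)"
  shows "multilinear A m (tensor_power A n)
    (\<lambda>a. pure_tensor A n (\<lambda>j\<in>{0..n}. \<Otimes>\<^bsub>A\<^esub>i\<in>{i \<in> {0..m}. \<phi> i = j}. a i))"
proof -
  have "linear_map A (tensor_power A n)
      (\<lambda>x. pure_tensor A n (\<lambda>j\<in>{0..n}. \<Otimes>\<^bsub>A\<^esub>k\<in>{k \<in> {0..m}. \<phi> k = j}. (a(i := x)) k))"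
    (is "linear_map _ _ ?f") if a: "a \<in> tuples A m" and i: "i \<in> {0..m}" for a i
  proof -
    let ?fib = "\<lambda>j. {i \<in> {0..m}. \<phi> i = j}"
    define b where "b = (\<lambda>j\<in>{0..n}. \<Otimes>\<^bsub>A\<^esub>i\<in>?fib j. a i)"
    define r where "r = (\<Otimes>\<^bsub>A\<^esub>k\<in>?fib (\<phi> i) - {i}. a k)"
    have b: "b \<in> tuples A n"
      unfolding b_def by (rule fibre_product_tuple[OF a])
    have r: "r \<in> carrier A"
      using a unfolding r_def by (intro A.finprod_closed) (auto simp: tuples_def)
    have j: "\<phi> i \<in> {0..n}"
      by (rule Gamma_map_image[OF \<phi> i])
    have upd: "(\<lambda>j\<in>{0..n}. \<Otimes>\<^bsub>A\<^esub>k\<in>?fib j. (a(i := x)) k) = b(\<phi> i := x \<otimes>\<^bsub>A\<^esub> r)"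
      if x: "x \<in> carrier A" for x
    proof
      fix j
      show "(\<lambda>j\<in>{0..n}. \<Otimes>\<^bsub>A\<^esub>k\<in>?fib j. (a(i := x)) k) j = (b(\<phi> i := x \<otimes>\<^bsub>A\<^esub> r)) j"
      proof (cases "j = \<phi> i")
        case True
        have "?fib (\<phi> i) = insert i (?fib (\<phi> i) - {i})"
          using i by auto
        then have "(\<Otimes>\<^bsub>A\<^esub>k\<in>?fib (\<phi> i). (a(i := x)) k) =
            (\<Otimes>\<^bsub>A\<^esub>k\<in>insert i (?fib (\<phi> i) - {i}). (a(i := x)) k)"
          by simp
        also have "\<dots> = x \<otimes>\<^bsub>A\<^esub> (\<Otimes>\<^bsub>A\<^esub>k\<in>?fib (\<phi> i) - {i}. (a(i := x)) k)"
          using a x by (subst A.finprod_insert) (auto simp: tuples_def)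
        also have "(\<Otimes>\<^bsub>A\<^esub>k\<in>?fib (\<phi> i) - {i}. (a(i := x)) k) = r"
          unfolding r_def using a by (intro A.finprod_cong') (auto simp: tuples_def)
        finally show ?thesis
          using True j by simp
      next
        case False
        then have "(\<Otimes>\<^bsub>A\<^esub>k\<in>?fib j. (a(i := x)) k) = (\<Otimes>\<^bsub>A\<^esub>k\<in>?fib j. a k)"
          using a by (intro A.finprod_cong') (auto simp: tuples_def)
        then show ?thesis
          using False by (auto simp: b_def)
      qed
    qed
    have "linear_map A A (\<lambda>x. x \<otimes>\<^bsub>A\<^esub> r)"
      using r by (intro linear_mapI) (auto simp: A.smult_assoc2 A.l_distr)
    then have "linear_map A (tensor_power A n) (\<lambda>x. pure_tensor A n (b(\<phi> i := x \<otimes>\<^bsub>A\<^esub> r)))"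
      by (rule linear_map_compose[OF _ multilinear_linear[OF multilinear_pure_tensor[OF module_A] b j]])
    then show "linear_map A (tensor_power A n) ?f"
      by (rule linear_map_cong[OF module_A]) (simp only: upd)
  qed
  then show ?thesis
    unfolding multilinear_def
    by (intro conjI ballI pure_tensor_closed[OF module_A] fibre_product_tuple)
qed

lemma Loday_Gamma_map_linear:
  assumes "\<phi> \<in> pointed_maps (Gamma_obj m) (Gamma_obj n)"
  shows "linear_map (tensor_power A m) (tensor_power A n) (Loday_Gamma_map A m n \<phi>)"
  unfolding Loday_Gamma_map_def
  by (rule Lin_linear[OF tensor_lift_Lin[OF module_A module_tensor_power[OF module_A]
          multilinear_Gamma_map[OF assms]]])

lemma Loday_Gamma_map_pure:
  assumes "\<phi> \<in> pointed_maps (Gamma_obj m) (Gamma_obj n)" "a \<in> tuples A m"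
  shows "Loday_Gamma_map A m n \<phi> (pure_tensor A m a) =
    pure_tensor A n (\<lambda>j\<in>{0..n}. \<Otimes>\<^bsub>A\<^esub>i\<in>{i \<in> {0..m}. \<phi> i = j}. a i)"
  unfolding Loday_Gamma_map_def
  by (rule tensor_lift_pure[OF module_A module_tensor_power[OF module_A]
        multilinear_Gamma_map[OF assms(1)] assms(2)])


subsection \<open>The universal property of the colimit\<close>

lemma Loday_summand_module: "module \<C> ((\<lambda>(m, \<phi>). tensor_power A m) z)"
  using module_tensor_power[OF module_A] by (simp add: split_def)

lemma module_Loday_sum: "module \<C> (Loday_sum A T)"
  unfolding Loday_sum_def by (rule module_direct_sum[OF Loday_summand_module])

lemma Loday_sum_inj_linear:
  assumes "(m, \<phi>) \<in> Gamma_over T"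
  shows "linear_map (tensor_power A m) (Loday_sum A T) (Loday_sum_inj A T (m, \<phi>))"
  using summand_inj_linear[of "Gamma_over T" "\<lambda>(m, \<phi>). tensor_power A m", OF Loday_summand_module assms]
  by (simp add: Loday_sum_def Loday_sum_inj_def)

lemma Loday_relations_closed: "Loday_relations A T \<subseteq> carrier (Loday_sum A T)"
proof -
  interpret S: module \<C> "Loday_sum A T" by (rule module_Loday_sum)
  show ?thesis
    unfolding Loday_relations_def
    by (auto intro!: S.minus_closed linear_map_closed[OF Loday_sum_inj_linear]
        linear_map_closed[OF Loday_Gamma_map_linear] Gamma_pointed_maps_compose simp: Gamma_over_iff)
qed

lemma submodule_Loday_relation_space: "submodule (Loday_relation_space A T) \<C> (Loday_sum A T)"
  unfolding Loday_relation_space_eq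
  by (rule submodule_subspace_span[OF module_Loday_sum Loday_relations_closed])

lemma module_Loday: "module \<C> (Loday A T)"
  unfolding Loday_def by (rule module_quotient[OF module_Loday_sum submodule_Loday_relation_space])

lemma Loday_proj_linear:
  "linear_map (Loday_sum A T) (Loday A T) (\<lambda>x. Loday_relation_space A T +>\<^bsub>Loday_sum A T\<^esub> x)"
  unfolding Loday_def by (rule quotient_linear_map[OF module_Loday_sum submodule_Loday_relation_space])

lemma Loday_inj_linear:
  assumes "(m, \<phi>) \<in> Gamma_over T"
  shows "linear_map (tensor_power A m) (Loday A T) (Loday_inj A T (m, \<phi>))"
  using linear_map_compose[OF Loday_sum_inj_linear[OF assms] Loday_proj_linear]
  by (simp add: Loday_inj_def[abs_def])

lemma Loday_inj_compat:
  assumes \<alpha>: "\<alpha> \<in> pointed_maps (Gamma_obj m) (Gamma_obj n)"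
    and \<psi>: "\<psi> \<in> pointed_maps (Gamma_obj n) T" and x: "x \<in> carrier (tensor_power A m)"
  shows "Loday_inj A T (m, compose {0..m} \<psi> \<alpha>) x = Loday_inj A T (n, \<psi>) (Loday_Gamma_map A m n \<alpha> x)"
proof -
  have "Loday_sum_inj A T (m, compose {0..m} \<psi> \<alpha>) x \<ominus>\<^bsub>Loday_sum A T\<^esub>
      Loday_sum_inj A T (n, \<psi>) (Loday_Gamma_map A m n \<alpha> x) \<in> Loday_relations A T"
    unfolding Loday_relations_def using assms by blast
  then have "Loday_sum_inj A T (m, compose {0..m} \<psi> \<alpha>) x \<ominus>\<^bsub>Loday_sum A T\<^esub>
      Loday_sum_inj A T (n, \<psi>) (Loday_Gamma_map A m n \<alpha> x) \<in> Loday_relation_space A T"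
    unfolding Loday_relation_space_eq
    by (rule subsetD[OF subspace_span_superset])
  then show ?thesis
    unfolding Loday_inj_def using assms
    by (intro iffD2[OF quotient_eq_iff[OF module_Loday_sum submodule_Loday_relation_space]])
      (auto intro!: linear_map_closed[OF Loday_sum_inj_linear]
        linear_map_closed[OF Loday_Gamma_map_linear] Gamma_pointed_maps_compose simp: Gamma_over_iff)
qed

text \<open>The images of the tensor powers span the colimit.\<close>

lemma Loday_eqI:
  assumes "module \<C> M" "linear_map (Loday A T) M f" "linear_map (Loday A T) M g"
    and eq: "\<And>m \<phi> x. (m, \<phi>) \<in> Gamma_over T \<Longrightarrow> x \<in> carrier (tensor_power A m) \<Longrightarrow>
      f (Loday_inj A T (m, \<phi>) x) = g (Loday_inj A T (m, \<phi>) x)"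
    and "y \<in> carrier (Loday A T)"
  shows "f y = g y"
proof -
  let ?S = "\<Union>z\<in>Gamma_over T. summand_inj (Gamma_over T) (\<lambda>(m, \<phi>). tensor_power A m) z `
    carrier ((\<lambda>(m, \<phi>). tensor_power A m) z)"
  let ?p = "\<lambda>x. Loday_relation_space A T +>\<^bsub>Loday_sum A T\<^esub> x"
  have "subspace_span (Loday A T) (?p ` ?S) = carrier (Loday A T)"
  proof (rule subspace_span_surj_image[OF module_Loday_sum module_Loday Loday_proj_linear])
    show "?p ` carrier (Loday_sum A T) = carrier (Loday A T)"
      unfolding Loday_def
      by (rule quotient_surj[OF module_Loday_sum submodule_Loday_relation_space, symmetric])
    show "subspace_span (Loday_sum A T) ?S = carrier (Loday_sum A T)"
      unfolding Loday_sum_def by (rule direct_sum_span[OF Loday_summand_module])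
  qed
  then show ?thesis
    by (rule linear_maps_eq_on_span[OF module_Loday assms(1-3) _ _ assms(5)])
      (use eq in \<open>auto simp: Loday_inj_def Loday_sum_inj_def\<close>)
qed

text \<open>A compatible family of linear maps on the tensor powers defines a unique map on the colimit.\<close>

lemma Loday_lift:
  assumes M: "module \<C> M"
    and f: "\<And>m \<phi>. (m, \<phi>) \<in> Gamma_over T \<Longrightarrow> linear_map (tensor_power A m) M (f (m, \<phi>))"
    and compat: "\<And>m n \<alpha> \<psi> x. \<alpha> \<in> pointed_maps (Gamma_obj m) (Gamma_obj n) \<Longrightarrow>
      \<psi> \<in> pointed_maps (Gamma_obj n) T \<Longrightarrow> x \<in> carrier (tensor_power A m) \<Longrightarrow>
      f (m, compose {0..m} \<psi> \<alpha>) x = f (n, \<psi>) (Loday_Gamma_map A m n \<alpha> x)"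
  shows "\<exists>!g. g \<in> Lin (Loday A T) M \<and> (\<forall>(m, \<phi>)\<in>Gamma_over T. \<forall>x\<in>carrier (tensor_power A m).
    g (Loday_inj A T (m, \<phi>) x) = f (m, \<phi>) x)" (is "\<exists>!g. ?P g")
proof (rule ex_ex1I)
  interpret M: module \<C> M by fact
  obtain h where h: "linear_map (Loday_sum A T) M h"
    "\<And>m \<phi> x. (m, \<phi>) \<in> Gamma_over T \<Longrightarrow> x \<in> carrier (tensor_power A m) \<Longrightarrow>
      h (Loday_sum_inj A T (m, \<phi>) x) = f (m, \<phi>) x"
    using direct_sum_lift[of "Gamma_over T" "\<lambda>(m, \<phi>). tensor_power A m", OF Loday_summand_module M, of f] f
    unfolding Loday_sum_def Loday_sum_inj_def by (force dest: Lin_linear)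
  have "h r = \<zero>\<^bsub>M\<^esub>" if "r \<in> Loday_relations A T" for r
    using that unfolding Loday_relations_def
  proof (elim CollectE exE conjE, goal_cases)
    case (1 m n \<alpha> \<psi> x)
    have o: "(m, compose {0..m} \<psi> \<alpha>) \<in> Gamma_over T" "(n, \<psi>) \<in> Gamma_over T"
      using 1 by (auto simp: Gamma_over_iff Gamma_pointed_maps_compose)
    have x': "Loday_Gamma_map A m n \<alpha> x \<in> carrier (tensor_power A n)"
      by (rule linear_map_closed[OF Loday_Gamma_map_linear[OF 1(2)] 1(4)])
    show ?case
      using compat[OF 1(2-4)] linear_map_closed[OF f[OF o(2)] x']
      by (simp add: 1(1) linear_map_minus[OF module_Loday_sum M h(1)] h(2) o 1(4) x'
          linear_map_closed[OF Loday_sum_inj_linear] M.minus_eq M.r_neg)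
  qed
  then have "h r = \<zero>\<^bsub>M\<^esub>" if "r \<in> Loday_relation_space A T" for r
    using linear_map_zero_on_span[OF module_Loday_sum M h(1) Loday_relations_closed] that
    unfolding Loday_relation_space_eq by blast
  then obtain g where g: "g \<in> Lin (Loday A T) M"
      "\<And>x. x \<in> carrier (Loday_sum A T) \<Longrightarrow> g (Loday_relation_space A T +>\<^bsub>Loday_sum A T\<^esub> x) = h x"
    using quotient_factor[OF module_Loday_sum submodule_Loday_relation_space M h(1)]
    unfolding Loday_def by blast
  show "\<exists>g. ?P g"
  proof (intro exI[of _ g] conjI g(1), safe)
    fix m \<phi> x assume "(m, \<phi>) \<in> Gamma_over T" "x \<in> carrier (tensor_power A m)"
    then show "g (Loday_inj A T (m, \<phi>) x) = f (m, \<phi>) x"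
      unfolding Loday_inj_def
      by (subst g(2)) (auto simp: h(2) intro: linear_map_closed[OF Loday_sum_inj_linear])
  qed
  fix g g' assume P: "?P g" "?P g'"
  have v: "k (Loday_inj A T (m, \<phi>) x) = f (m, \<phi>) x"
    if "?P k" "(m, \<phi>) \<in> Gamma_over T" "x \<in> carrier (tensor_power A m)" for k m \<phi> x
    using bspec[OF conjunct2[OF that(1)] that(2)] that(3) by simp
  show "g = g'"
    by (rule Lin_eqI[OF conjunct1[OF P(1)] conjunct1[OF P(2)]],
        rule Loday_eqI[OF M Lin_linear[OF conjunct1[OF P(1)]] Lin_linear[OF conjunct1[OF P(2)]]])
      (simp_all only: v[OF P(1)] v[OF P(2)])
qed

text \<open>
  Functoriality: \<open>h\<close> sends the copy of \<open>\<L>(A)([m])\<close> indexed by \<open>\<phi>\<close> identically to the copy indexed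
  by \<open>h \<circ> \<phi>\<close>, and this family is compatible.
\<close>

lemma
  assumes h: "h \<in> pointed_maps S T"
  shows Loday_map_linear: "linear_map (Loday A S) (Loday A T) (Loday_map A S T h)"
    and Loday_map_inj: "\<And>m \<phi> x. (m, \<phi>) \<in> Gamma_over S \<Longrightarrow> x \<in> carrier (tensor_power A m) \<Longrightarrow>
      Loday_map A S T h (Loday_inj A S (m, \<phi>) x) = Loday_inj A T (m, compose {0..m} h \<phi>) x"
proof -
  have "\<exists>!g. g \<in> Lin (Loday A S) (Loday A T) \<and>
      (\<forall>(m, \<phi>)\<in>Gamma_over S. \<forall>x\<in>carrier (tensor_power A m).
        g (Loday_inj A S (m, \<phi>) x) = (\<lambda>(m, \<phi>). Loday_inj A T (m, compose {0..m} h \<phi>)) (m, \<phi>) x)"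
  proof (rule Loday_lift[OF module_Loday])
    fix m \<phi> assume "(m, \<phi>) \<in> Gamma_over S"
    then show "linear_map (tensor_power A m) (Loday A T)
        ((\<lambda>(m, \<phi>). Loday_inj A T (m, compose {0..m} h \<phi>)) (m, \<phi>))"
      using Gamma_pointed_maps_compose[OF _ h] by (simp add: Gamma_over_iff Loday_inj_linear)
  next
    fix m n \<alpha> \<psi> x
    assume \<alpha>: "\<alpha> \<in> pointed_maps (Gamma_obj m) (Gamma_obj n)" and \<psi>: "\<psi> \<in> pointed_maps (Gamma_obj n) S"
      and x: "x \<in> carrier (tensor_power A m)"
    have "compose {0..m} h (compose {0..m} \<psi> \<alpha>) = compose {0..m} (compose {0..n} h \<psi>) \<alpha>"
      using \<alpha> by (intro compose_compose) (auto simp: pointed_maps_def Gamma_obj_def)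
    then show "(\<lambda>(m, \<phi>). Loday_inj A T (m, compose {0..m} h \<phi>)) (m, compose {0..m} \<psi> \<alpha>) x =
        (\<lambda>(m, \<phi>). Loday_inj A T (m, compose {0..m} h \<phi>)) (n, \<psi>) (Loday_Gamma_map A m n \<alpha> x)"
      using Loday_inj_compat[OF \<alpha> Gamma_pointed_maps_compose[OF \<psi> h] x] by simp
  qed
  from theI'[OF this] show "linear_map (Loday A S) (Loday A T) (Loday_map A S T h)"
    "\<And>m \<phi> x. (m, \<phi>) \<in> Gamma_over S \<Longrightarrow> x \<in> carrier (tensor_power A m) \<Longrightarrow>
      Loday_map A S T h (Loday_inj A S (m, \<phi>) x) = Loday_inj A T (m, compose {0..m} h \<phi>) x"
    unfolding Loday_map_def by (auto dest: Lin_linear)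
qed

end


section \<open>Higher derivations and naturality\<close>

text \<open>
  The families \<open>p\<close> of natural numbers indexed by \<open>S\<close> with sum \<open>k\<close>, as extensional functions.
\<close>

definition weak_compositions :: "nat set \<Rightarrow> nat \<Rightarrow> (nat \<Rightarrow> nat) set"
  where "weak_compositions S k = {p \<in> S \<rightarrow>\<^sub>E UNIV. (\<Sum>i\<in>S. p i) = k}"

lemma finite_weak_compositions:
  assumes "finite S"
  shows "finite (weak_compositions S k)"
proof (rule finite_subset)
  show "weak_compositions S k \<subseteq> (\<Pi>\<^sub>E i\<in>S. {..k})"
    using assms by (auto simp: weak_compositions_def PiE_iff extensional_def intro!: member_le_sum)
qed (use assms in \<open>auto intro: finite_PiE\<close>)

text \<open>A weak composition of \<open>k\<close> indexed by \<open>insert x S\<close> is a first part \<open>i \<le> k\<close> and one of \<open>k - i\<close>.\<close>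

lemma bij_weak_compositions_insert:
  assumes "finite S" "x \<notin> S" "i \<le> k"
  shows "bij_betw (\<lambda>p. p(x := i)) (weak_compositions S (k - i))
    {p \<in> weak_compositions (insert x S) k. p x = i}"
proof (rule bij_betwI[where g = "\<lambda>p. restrict p S"])
  have upd: "(\<Sum>j\<in>S. (p(x := i)) j) = (\<Sum>j\<in>S. p j)" for p :: "nat \<Rightarrow> nat"
    using assms(2) by (intro sum.cong) auto
  show "(\<lambda>p. p(x := i)) \<in> weak_compositions S (k - i) \<rightarrow> {p \<in> weak_compositions (insert x S) k. p x = i}"
    using assms upd by (auto simp: weak_compositions_def PiE_iff extensional_def)
  show "(\<lambda>p. restrict p S) \<in> {p \<in> weak_compositions (insert x S) k. p x = i} \<rightarrow> weak_compositions S (k - i)"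
    using assms by (auto simp: weak_compositions_def)
next
  fix p assume "p \<in> weak_compositions S (k - i)"
  then show "restrict (p(x := i)) S = p"
    using assms(2) by (auto simp: weak_compositions_def PiE_iff extensional_def fun_eq_iff)
next
  fix p assume p: "p \<in> {p \<in> weak_compositions (insert x S) k. p x = i}"
  have "((restrict p S)(x := i)) j = p j" for j
    using p by (cases "j = x"; cases "j \<in> S") (auto simp: weak_compositions_def PiE_iff extensional_def)
  then show "(restrict p S)(x := i) = p" ..
qed

text \<open>
  A weak composition indexed by \<open>{0..m}\<close> is the same as a weak composition \<open>r\<close> indexed by
  \<open>{0..n}\<close>, namely that of its fib_sum along the fibres of \<open>\<phi>\<close>, together with, for each \<open>j\<close>, a weak
  composition of \<open>r j\<close> indexed by the fibre over \<open>j\<close>.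
\<close>

lemma bij_weak_compositions_fibres:
  assumes \<phi>: "\<And>i. i \<in> {0..m} \<Longrightarrow> \<phi> i \<in> {0..n}"
    and r: "r \<in> weak_compositions {0..n} k"
  shows "bij_betw (\<lambda>f. \<lambda>i\<in>{0..m}. f (\<phi> i) i)
    (\<Pi>\<^sub>E j\<in>{0..n}. weak_compositions {i \<in> {0..m}. \<phi> i = j} (r j))
    {p \<in> weak_compositions {0..m} k. (\<lambda>j\<in>{0..n}. \<Sum>i\<in>{i \<in> {0..m}. \<phi> i = j}. p i) = r}"
    (is "bij_betw ?u ?F ?P")
proof (rule bij_betwI[where g = "\<lambda>p. \<lambda>j\<in>{0..n}. restrict p {i \<in> {0..m}. \<phi> i = j}"])
  let ?fib = "\<lambda>j. {i \<in> {0..m}. \<phi> i = j}"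
  have group: "(\<Sum>i\<in>{0..m}. p i) = (\<Sum>j\<in>{0..n}. \<Sum>i\<in>?fib j. p i)" for p :: "nat \<Rightarrow> nat"
    using \<phi> by (intro sum.group[symmetric]) auto
  show "?u \<in> ?F \<rightarrow> ?P"
  proof
    fix f assume f: "f \<in> ?F"
    have s: "(\<Sum>i\<in>?fib j. ?u f i) = r j" if j: "j \<in> {0..n}" for j
    proof -
      have "(\<Sum>i\<in>?fib j. ?u f i) = (\<Sum>i\<in>?fib j. f j i)"
        by (intro sum.cong) auto
      then show ?thesis
        using PiE_mem[OF f j] by (simp add: weak_compositions_def)
    qed
    have "(\<Sum>i\<in>{0..m}. ?u f i) = (\<Sum>j\<in>{0..n}. r j)"
      unfolding group by (intro sum.cong refl s)
    then have "?u f \<in> weak_compositions {0..m} k"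
      using r by (simp add: weak_compositions_def)
    moreover have "(\<lambda>j\<in>{0..n}. \<Sum>i\<in>?fib j. ?u f i) = r"
      using s r by (intro extensionalityI[of _ "{0..n}"]) (auto simp: weak_compositions_def PiE_iff)
    ultimately show "?u f \<in> ?P" by simp
  qed
  show "(\<lambda>p. \<lambda>j\<in>{0..n}. restrict p (?fib j)) \<in> ?P \<rightarrow> ?F"
    by (auto simp: weak_compositions_def split: if_splits)
  show "?u (\<lambda>j\<in>{0..n}. restrict p (?fib j)) = p" if "p \<in> ?P" for p
    using that \<phi> by (intro extensionalityI[of _ "{0..m}"]) (auto simp: weak_compositions_def PiE_iff)
  show "(\<lambda>j\<in>{0..n}. restrict (?u f) (?fib j)) = f" if f: "f \<in> ?F" for f
  proof (rule extensionalityI[of _ "{0..n}"])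
    fix j assume j: "j \<in> {0..n}"
    have "restrict (?u f) (?fib j) = f j"
      using PiE_mem[OF f j]
      by (intro extensionalityI[of _ "?fib j"]) (auto simp: weak_compositions_def PiE_iff)
    then show "(\<lambda>j\<in>{0..n}. restrict (?u f) (?fib j)) j = f j"
      using j by simp
  qed (use f in \<open>auto simp: PiE_iff\<close>)
qed


context
  fixes A :: "(complex, 'a) module" and D :: "nat \<Rightarrow> 'a \<Rightarrow> 'a"
  assumes algebra: "algebra \<C> A"
    and derivation: "higher_derivation A D" and normalized: "normalized_derivation A D"
begin

interpretation A: algebra \<C> A by (rule algebra)

lemma D_linear: "linear_map A A (D n)"
  using derivation by (simp add: higher_derivation_def)

lemma D_closed: "x \<in> carrier A \<Longrightarrow> D n x \<in> carrier A"
  by (rule linear_map_closed[OF D_linear])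

lemma D_mult: "x \<in> carrier A \<Longrightarrow> y \<in> carrier A \<Longrightarrow>
    D n (x \<otimes>\<^bsub>A\<^esub> y) = (\<Oplus>\<^bsub>A\<^esub>i\<in>{0..n}. D i x \<otimes>\<^bsub>A\<^esub> D (n - i) y)"
  using derivation by (simp add: higher_derivation_def)

text \<open>
  For \<open>k > 0\<close> the inner terms of the Leibniz rule for \<open>D\<^sub>k(1 \<cdot> 1)\<close> vanish by induction and, since
  \<open>D\<^sub>0(1) = 1\<close>, each of the two outer ones is \<open>D\<^sub>k(1)\<close>. So \<open>D\<^sub>k(1) = D\<^sub>k(1) + D\<^sub>k(1)\<close>.
\<close>

lemma D_one: "D k \<one>\<^bsub>A\<^esub> = (if k = 0 then \<one>\<^bsub>A\<^esub> else \<zero>\<^bsub>A\<^esub>)"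
proof (induction k rule: less_induct)
  case (less k)
  show ?case
  proof (cases "k = 0")
    case True
    then show ?thesis
      using normalized by (simp add: normalized_derivation_def)
  next
    case False
    let ?d = "D k \<one>\<^bsub>A\<^esub>"
    have d: "?d \<in> carrier A"
      by (simp add: D_closed)
    have d0: "D 0 \<one>\<^bsub>A\<^esub> = \<one>\<^bsub>A\<^esub>"
      using normalized by (simp add: normalized_derivation_def)
    have "?d = (\<Oplus>\<^bsub>A\<^esub>i\<in>{0..k}. D i \<one>\<^bsub>A\<^esub> \<otimes>\<^bsub>A\<^esub> D (k - i) \<one>\<^bsub>A\<^esub>)"
      using D_mult[of "\<one>\<^bsub>A\<^esub>" "\<one>\<^bsub>A\<^esub>" k] by simp
    also have "\<dots> = (\<Oplus>\<^bsub>A\<^esub>i\<in>{0, k}. D i \<one>\<^bsub>A\<^esub> \<otimes>\<^bsub>A\<^esub> D (k - i) \<one>\<^bsub>A\<^esub>)"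
      using less by (intro A.add.finprod_mono_neutral_cong_right) (auto simp: D_closed)
    also have "\<dots> = ?d \<oplus>\<^bsub>A\<^esub> ?d"
      using False d by (simp add: D_closed d0)
    finally show ?thesis
      using False d by (metis A.M.add.r_cancel_one')
  qed
qed

text \<open>The iterated Leibniz rule; the induction splits off the index \<open>p x\<close> that falls on \<open>a x\<close>.\<close>

lemma D_finprod:
  assumes "finite S" "a \<in> S \<rightarrow> carrier A"
  shows "D k (\<Otimes>\<^bsub>A\<^esub>i\<in>S. a i) = (\<Oplus>\<^bsub>A\<^esub>p\<in>weak_compositions S k. \<Otimes>\<^bsub>A\<^esub>i\<in>S. D (p i) (a i))"
  using assms
proof (induction S arbitrary: k)
  case empty
  \<comment> \<open>The empty product is \<open>1\<close>, and the empty family is the only one, with sum \<open>0\<close>.\<close>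
  have "weak_compositions {} k = (if k = 0 then {\<lambda>_. undefined} else {})"
    by (auto simp: weak_compositions_def)
  then show ?case
    by (simp add: D_one)
next
  case (insert x S)
  have S: "finite S" "x \<notin> S" and ax: "a x \<in> carrier A" and aS: "a \<in> S \<rightarrow> carrier A"
    using insert by auto
  have pr: "(\<Otimes>\<^bsub>A\<^esub>j\<in>S. D (p j) (a j)) \<in> carrier A" for p
    using aS by (intro A.finprod_closed) (auto intro: D_closed)
  have "D k (\<Otimes>\<^bsub>A\<^esub>i\<in>insert x S. a i) = D k (a x \<otimes>\<^bsub>A\<^esub> (\<Otimes>\<^bsub>A\<^esub>i\<in>S. a i))"
    using S ax aS by simp
  also have "\<dots> = (\<Oplus>\<^bsub>A\<^esub>i\<in>{0..k}. D i (a x) \<otimes>\<^bsub>A\<^esub> D (k - i) (\<Otimes>\<^bsub>A\<^esub>i\<in>S. a i))"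
    using aS by (intro D_mult[OF ax] A.finprod_closed)
  also have "\<dots> = (\<Oplus>\<^bsub>A\<^esub>i\<in>{0..k}. \<Oplus>\<^bsub>A\<^esub>p\<in>{p \<in> weak_compositions (insert x S) k. p x = i}.
      \<Otimes>\<^bsub>A\<^esub>j\<in>insert x S. D (p j) (a j))"
  proof (intro A.finsum_cong' refl Pi_I)
    fix i assume i: "i \<in> {0..k}"
    have tm: "(\<Otimes>\<^bsub>A\<^esub>j\<in>insert x S. D (p j) (a j)) \<in> carrier A" for p
      using ax aS by (intro A.finprod_closed) (auto intro: D_closed)
    then show "(\<Oplus>\<^bsub>A\<^esub>p\<in>{p \<in> weak_compositions (insert x S) k. p x = i}.
        \<Otimes>\<^bsub>A\<^esub>j\<in>insert x S. D (p j) (a j)) \<in> carrier A"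
      by (intro A.finsum_closed) auto
    have "D i (a x) \<otimes>\<^bsub>A\<^esub> D (k - i) (\<Otimes>\<^bsub>A\<^esub>i\<in>S. a i) =
        D i (a x) \<otimes>\<^bsub>A\<^esub> (\<Oplus>\<^bsub>A\<^esub>p\<in>weak_compositions S (k - i). \<Otimes>\<^bsub>A\<^esub>j\<in>S. D (p j) (a j))"
      by (simp only: insert.IH[OF aS])
    also have "\<dots> = (\<Oplus>\<^bsub>A\<^esub>p\<in>weak_compositions S (k - i). D i (a x) \<otimes>\<^bsub>A\<^esub> (\<Otimes>\<^bsub>A\<^esub>j\<in>S. D (p j) (a j)))"
      using pr by (intro A.finsum_rdistr finite_weak_compositions S D_closed ax) auto
    also have "\<dots> = (\<Oplus>\<^bsub>A\<^esub>p\<in>weak_compositions S (k - i). \<Otimes>\<^bsub>A\<^esub>j\<in>insert x S. D ((p(x := i)) j) (a j))"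
    proof (intro A.finsum_cong' refl Pi_I)
      fix p :: "nat \<Rightarrow> nat"
      have "(\<Otimes>\<^bsub>A\<^esub>j\<in>S. D ((p(x := i)) j) (a j)) = (\<Otimes>\<^bsub>A\<^esub>j\<in>S. D (p j) (a j))"
        using S aS by (intro A.finprod_cong') (auto intro: D_closed)
      then show "D i (a x) \<otimes>\<^bsub>A\<^esub> (\<Otimes>\<^bsub>A\<^esub>j\<in>S. D (p j) (a j)) =
          (\<Otimes>\<^bsub>A\<^esub>j\<in>insert x S. D ((p(x := i)) j) (a j))"
        using S ax aS by (subst A.finprod_insert) (auto intro!: D_closed)
    qed (rule tm)
    also have "\<dots> = (\<Oplus>\<^bsub>A\<^esub>p\<in>{p \<in> weak_compositions (insert x S) k. p x = i}.
        \<Otimes>\<^bsub>A\<^esub>j\<in>insert x S. D (p j) (a j))"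
      using i tm by (intro A.finsum_bij[symmetric] bij_weak_compositions_insert S) auto
    finally show "D i (a x) \<otimes>\<^bsub>A\<^esub> D (k - i) (\<Otimes>\<^bsub>A\<^esub>i\<in>S. a i) =
      (\<Oplus>\<^bsub>A\<^esub>p\<in>{p \<in> weak_compositions (insert x S) k. p x = i}. \<Otimes>\<^bsub>A\<^esub>j\<in>insert x S. D (p j) (a j))" .
  qed
  also have "\<dots> = (\<Oplus>\<^bsub>A\<^esub>p\<in>weak_compositions (insert x S) k. \<Otimes>\<^bsub>A\<^esub>j\<in>insert x S. D (p j) (a j))"
  proof (intro A.finsum_fibres[symmetric] finite_weak_compositions)
    show "(\<lambda>p. p x) \<in> weak_compositions (insert x S) k \<rightarrow> {0..k}"
      using S by (auto simp: weak_compositions_def)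
    show "(\<lambda>p. \<Otimes>\<^bsub>A\<^esub>j\<in>insert x S. D (p j) (a j)) \<in> weak_compositions (insert x S) k \<rightarrow> carrier A"
      using ax aS by (intro Pi_I A.finprod_closed) (auto intro: D_closed)
  qed (use S in auto)
  finally show ?case .
qed


subsection \<open>The operator on tensor powers\<close>

lemma D_tuple: "a \<in> tuples A n \<Longrightarrow> (\<lambda>i\<in>{0..n}. D (p i) (a i)) \<in> tuples A n"
  by (auto simp: tuples_def intro!: D_closed)

lemma multilinear_L:
  "multilinear A n (tensor_power A n)
    (\<lambda>a. \<Oplus>\<^bsub>tensor_power A n\<^esub>p\<in>weak_compositions {0..n} k. pure_tensor A n (\<lambda>i\<in>{0..n}. D (p i) (a i)))"
  by (intro multilinear_sum multilinear_precompose module_A[OF algebra] module_tensor_power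
      multilinear_pure_tensor D_linear)

lemma L_Gamma_linear: "linear_map (tensor_power A n) (tensor_power A n) (L_Gamma A D k n)"
  using Lin_linear[OF tensor_lift_Lin[OF module_A[OF algebra]
        module_tensor_power[OF module_A[OF algebra]] multilinear_L]]
  by (simp add: L_Gamma_def weak_compositions_def)

lemma L_Gamma_pure:
  assumes "a \<in> tuples A n"
  shows "L_Gamma A D k n (pure_tensor A n a) =
    (\<Oplus>\<^bsub>tensor_power A n\<^esub>p\<in>weak_compositions {0..n} k. pure_tensor A n (\<lambda>i\<in>{0..n}. D (p i) (a i)))"
  using tensor_lift_pure[OF module_A[OF algebra] module_tensor_power[OF module_A[OF algebra]]
      multilinear_L assms]
  by (simp add: L_Gamma_def weak_compositions_def)

text \<open>
  Both sides are evaluated on pure tensors and compared with the sum of the tensors \<open>t p\<close>, which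
  have \<open>j\<close>-th factor the product of the \<open>D\<^bsub>p i\<^esub>(a\<^sub>i)\<close> over the fibre of \<open>\<phi>\<close> over \<open>j\<close>; the sum is
  grouped by the sums \<open>fib_sum p\<close> of \<open>p\<close> along the fibres.
\<close>

lemma L_Gamma_natural:
  assumes \<phi>: "\<phi> \<in> pointed_maps (Gamma_obj m) (Gamma_obj n)" and x: "x \<in> carrier (tensor_power A m)"
  shows "Loday_Gamma_map A m n \<phi> (L_Gamma A D k m x) = L_Gamma A D k n (Loday_Gamma_map A m n \<phi> x)"
proof (rule tensor_power_eqI[OF module_A[OF algebra] module_tensor_power[OF module_A[OF algebra]] _ _ _ x])
  show "linear_map (tensor_power A m) (tensor_power A n) (\<lambda>x. Loday_Gamma_map A m n \<phi> (L_Gamma A D k m x))"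
    by (rule linear_map_compose[OF L_Gamma_linear Loday_Gamma_map_linear[OF algebra \<phi>]])
  show "linear_map (tensor_power A m) (tensor_power A n) (\<lambda>x. L_Gamma A D k n (Loday_Gamma_map A m n \<phi> x))"
    by (rule linear_map_compose[OF Loday_Gamma_map_linear[OF algebra \<phi>] L_Gamma_linear])
  fix a assume a: "a \<in> tuples A m"
  let ?fib = "\<lambda>j. {i \<in> {0..m}. \<phi> i = j}"
  let ?T = "tensor_power A n"
  define t where "t p = pure_tensor A n (\<lambda>j\<in>{0..n}. \<Otimes>\<^bsub>A\<^esub>i\<in>?fib j. D (p i) (a i))" for p
  define b where "b = (\<lambda>j\<in>{0..n}. \<Otimes>\<^bsub>A\<^esub>i\<in>?fib j. a i)"
  define fib_sum where "fib_sum p = (\<lambda>j\<in>{0..n}. \<Sum>i\<in>?fib j. p i)" for p :: "nat \<Rightarrow> nat"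
  note modA = module_A[OF algebra]
  note modT = module_tensor_power[OF modA]
  interpret T: module \<C> ?T by (rule modT)
  have aA: "a i \<in> carrier A" if "i \<in> {0..m}" for i
    using a that by (auto simp: tuples_def)
  have b: "b \<in> tuples A n"
    unfolding b_def by (rule fibre_product_tuple[OF algebra a])
  have \<phi>n: "\<phi> i \<in> {0..n}" if "i \<in> {0..m}" for i
    by (rule Gamma_map_image[OF \<phi> that])
  have t: "t p \<in> carrier ?T" for p
    unfolding t_def using aA
    by (intro pure_tensor_closed[OF modA]) (auto simp: tuples_def intro!: A.finprod_closed D_closed)
  have restr: "(\<lambda>j\<in>{0..n}. \<Otimes>\<^bsub>A\<^esub>i\<in>?fib j. (\<lambda>i\<in>{0..m}. D (p i) (a i)) i) =
      (\<lambda>j\<in>{0..n}. \<Otimes>\<^bsub>A\<^esub>i\<in>?fib j. D (p i) (a i))" for p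
    using aA by (intro restrict_ext A.finprod_cong') (auto intro!: D_closed)
  have "Loday_Gamma_map A m n \<phi> (L_Gamma A D k m (pure_tensor A m a)) =
      (\<Oplus>\<^bsub>?T\<^esub>p\<in>weak_compositions {0..m} k.
        Loday_Gamma_map A m n \<phi> (pure_tensor A m (\<lambda>i\<in>{0..m}. D (p i) (a i))))"
    unfolding L_Gamma_pure[OF a]
    by (rule linear_map_finsum[OF module_tensor_power[OF modA] modT Loday_Gamma_map_linear[OF algebra \<phi>]])
      (intro Pi_I pure_tensor_closed[OF modA] D_tuple a)
  also have "\<dots> = (\<Oplus>\<^bsub>?T\<^esub>p\<in>weak_compositions {0..m} k. t p)"
    unfolding Loday_Gamma_map_pure[OF algebra \<phi> D_tuple[OF a]] restr t_def ..
  also have "\<dots> = (\<Oplus>\<^bsub>?T\<^esub>r\<in>weak_compositions {0..n} k.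
      \<Oplus>\<^bsub>?T\<^esub>p\<in>{p \<in> weak_compositions {0..m} k. fib_sum p = r}. t p)"
  proof (intro T.finsum_fibres finite_weak_compositions)
    show "fib_sum \<in> weak_compositions {0..m} k \<rightarrow> weak_compositions {0..n} k"
    proof
      fix p assume "p \<in> weak_compositions {0..m} k"
      moreover have "(\<Sum>j\<in>{0..n}. \<Sum>i\<in>?fib j. p i) = (\<Sum>i\<in>{0..m}. p i)"
        using \<phi>n by (intro sum.group) auto
      ultimately show "fib_sum p \<in> weak_compositions {0..n} k"
        by (simp add: weak_compositions_def fib_sum_def)
    qed
  qed (use t in auto)
  also have "\<dots> = (\<Oplus>\<^bsub>?T\<^esub>r\<in>weak_compositions {0..n} k. pure_tensor A n (\<lambda>j\<in>{0..n}. D (r j) (b j)))"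
  proof (intro T.finsum_cong' refl Pi_I)
    fix r assume r: "r \<in> weak_compositions {0..n} k"
    show "pure_tensor A n (\<lambda>j\<in>{0..n}. D (r j) (b j)) \<in> carrier ?T"
      by (intro pure_tensor_closed[OF modA] D_tuple b)
    have "(\<Oplus>\<^bsub>?T\<^esub>p\<in>{p \<in> weak_compositions {0..m} k. fib_sum p = r}. t p) =
        (\<Oplus>\<^bsub>?T\<^esub>f\<in>(\<Pi>\<^sub>E j\<in>{0..n}. weak_compositions (?fib j) (r j)). t (\<lambda>i\<in>{0..m}. f (\<phi> i) i))"
      unfolding fib_sum_def by (intro T.finsum_bij bij_weak_compositions_fibres \<phi>n r) (use t in auto)
    also have "\<dots> = (\<Oplus>\<^bsub>?T\<^esub>f\<in>(\<Pi>\<^sub>E j\<in>{0..n}. weak_compositions (?fib j) (r j)).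
        pure_tensor A n (\<lambda>j\<in>{0..n}. \<Otimes>\<^bsub>A\<^esub>i\<in>?fib j. D (f j i) (a i)))"
    proof (rule arg_cong[where f = "\<lambda>h. finsum ?T h _"], rule ext)
      fix f
      have "(\<lambda>j\<in>{0..n}. \<Otimes>\<^bsub>A\<^esub>i\<in>?fib j. D ((\<lambda>i\<in>{0..m}. f (\<phi> i) i) i) (a i)) =
          (\<lambda>j\<in>{0..n}. \<Otimes>\<^bsub>A\<^esub>i\<in>?fib j. D (f j i) (a i))"
        using aA by (intro restrict_ext A.finprod_cong') (auto intro!: D_closed)
      then show "t (\<lambda>i\<in>{0..m}. f (\<phi> i) i) = pure_tensor A n (\<lambda>j\<in>{0..n}. \<Otimes>\<^bsub>A\<^esub>i\<in>?fib j. D (f j i) (a i))"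
        by (simp only: t_def)
    qed
    also have "\<dots> = pure_tensor A n (\<lambda>j\<in>{0..n}.
        \<Oplus>\<^bsub>A\<^esub>p\<in>weak_compositions (?fib j) (r j). \<Otimes>\<^bsub>A\<^esub>i\<in>?fib j. D (p i) (a i))"
      using aA by (intro multilinear_expand[OF modA modT multilinear_pure_tensor[OF modA], symmetric]
          finite_weak_compositions A.finprod_closed) (auto intro!: D_closed)
    also have "\<dots> = pure_tensor A n (\<lambda>j\<in>{0..n}. D (r j) (b j))"
      using aA by (intro arg_cong[of _ _ "pure_tensor A n"] restrict_ext)
        (auto simp: b_def D_finprod)
    finally show "(\<Oplus>\<^bsub>?T\<^esub>p\<in>{p \<in> weak_compositions {0..m} k. fib_sum p = r}. t p) =
      pure_tensor A n (\<lambda>j\<in>{0..n}. D (r j) (b j))" .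
  qed
  also have "\<dots> = L_Gamma A D k n (Loday_Gamma_map A m n \<phi> (pure_tensor A m a))"
    unfolding Loday_Gamma_map_pure[OF algebra \<phi> a] b_def[symmetric] L_Gamma_pure[OF b] ..
  finally show "Loday_Gamma_map A m n \<phi> (L_Gamma A D k m (pure_tensor A m a)) =
    L_Gamma A D k n (Loday_Gamma_map A m n \<phi> (pure_tensor A m a))" .
qed


subsection \<open>The operator on the Loday functor\<close>

text \<open>Naturality over \<open>\<Gamma>\<close> is the compatibility by which the operator passes to the colimit.\<close>

lemma
  shows L_map_linear: "linear_map (Loday A T) (Loday A T) (L_map A D k T)"
    and L_map_inj: "\<And>m \<phi> x. (m, \<phi>) \<in> Gamma_over T \<Longrightarrow> x \<in> carrier (tensor_power A m) \<Longrightarrow>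
      L_map A D k T (Loday_inj A T (m, \<phi>) x) = Loday_inj A T (m, \<phi>) (L_Gamma A D k m x)"
proof -
  have "\<exists>!g. g \<in> Lin (Loday A T) (Loday A T) \<and>
      (\<forall>(m, \<phi>)\<in>Gamma_over T. \<forall>x\<in>carrier (tensor_power A m).
        g (Loday_inj A T (m, \<phi>) x) = (\<lambda>(m, \<phi>) x. Loday_inj A T (m, \<phi>) (L_Gamma A D k m x)) (m, \<phi>) x)"
  proof (rule Loday_lift[OF algebra module_Loday[OF algebra]])
    fix m \<phi> assume "(m, \<phi>) \<in> Gamma_over T"
    then show "linear_map (tensor_power A m) (Loday A T)
        ((\<lambda>(m, \<phi>) x. Loday_inj A T (m, \<phi>) (L_Gamma A D k m x)) (m, \<phi>))"
      using linear_map_compose[OF L_Gamma_linear Loday_inj_linear[OF algebra]] by simp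
  next
    fix m n \<alpha> \<psi> x
    assume \<alpha>: "\<alpha> \<in> pointed_maps (Gamma_obj m) (Gamma_obj n)" and \<psi>: "\<psi> \<in> pointed_maps (Gamma_obj n) T"
      and x: "x \<in> carrier (tensor_power A m)"
    show "(\<lambda>(m, \<phi>) x. Loday_inj A T (m, \<phi>) (L_Gamma A D k m x)) (m, compose {0..m} \<psi> \<alpha>) x =
        (\<lambda>(m, \<phi>) x. Loday_inj A T (m, \<phi>) (L_Gamma A D k m x)) (n, \<psi>) (Loday_Gamma_map A m n \<alpha> x)"
      using Loday_inj_compat[OF algebra \<alpha> \<psi> linear_map_closed[OF L_Gamma_linear x]]
        L_Gamma_natural[OF \<alpha> x] by simp
  qed
  from theI'[OF this] show "linear_map (Loday A T) (Loday A T) (L_map A D k T)"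
    "\<And>m \<phi> x. (m, \<phi>) \<in> Gamma_over T \<Longrightarrow> x \<in> carrier (tensor_power A m) \<Longrightarrow>
      L_map A D k T (Loday_inj A T (m, \<phi>) x) = Loday_inj A T (m, \<phi>) (L_Gamma A D k m x)"
    unfolding L_map_def by (auto dest: Lin_linear)
qed

lemma L_map_natural:
  assumes h: "h \<in> pointed_maps S T" and y: "y \<in> carrier (Loday A S)"
  shows "Loday_map A S T h (L_map A D k S y) = L_map A D k T (Loday_map A S T h y)"
proof (rule Loday_eqI[OF algebra module_Loday[OF algebra] _ _ _ y])
  show "linear_map (Loday A S) (Loday A T) (\<lambda>y. Loday_map A S T h (L_map A D k S y))"
    by (rule linear_map_compose[OF L_map_linear Loday_map_linear[OF algebra h]])
  show "linear_map (Loday A S) (Loday A T) (\<lambda>y. L_map A D k T (Loday_map A S T h y))"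
    by (rule linear_map_compose[OF Loday_map_linear[OF algebra h] L_map_linear])
  fix m \<phi> x assume z: "(m, \<phi>) \<in> Gamma_over S" and x: "x \<in> carrier (tensor_power A m)"
  have z': "(m, compose {0..m} h \<phi>) \<in> Gamma_over T"
    using z Gamma_pointed_maps_compose[OF _ h] by (simp add: Gamma_over_iff)
  show "Loday_map A S T h (L_map A D k S (Loday_inj A S (m, \<phi>) x)) =
      L_map A D k T (Loday_map A S T h (Loday_inj A S (m, \<phi>) x))"
    by (simp add: L_map_inj Loday_map_inj[OF algebra h] z z' x linear_map_closed[OF L_Gamma_linear])
qed

end


section \<open>Homology of sequences of vector spaces\<close>

text \<open>
  Let \<open>C\<close> be any sequence of vector spaces with linear maps \<open>b\<close> of degree \<open>-1\<close>, and \<open>Z\<close> and \<open>B\<close> the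
  kernel of \<open>b\<^sup>i\<close> and the image of \<open>b\<^bsup>N - i\<^esup>\<close> in \<open>C n\<close>. The space \<^const>\<open>N_homology\<close> consists of the cosets
  in \<open>C n\<close> of \<open>B\<close> by elements of \<open>Z\<close>, so it is the vector space \<open>(Z + B) / B\<close>, which is \<open>Z / B\<close> if
  \<open>B \<subseteq> Z\<close>. A linear map on \<open>Z\<close> passes to it if it vanishes on \<open>Z \<inter> B\<close>.
\<close>

context
  fixes C :: "int \<Rightarrow> (complex, 'v) module" and b :: "int \<Rightarrow> 'v \<Rightarrow> 'v" and N :: nat
  assumes C: "\<And>n. module \<C> (C n)" and b: "\<And>n. linear_map (C n) (C (n - 1)) (b n)"
begin

lemma iterate_linear: "linear_map (C n) (C (n - int i)) (iterate b i n)"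
proof (induction i)
  case 0
  show ?case
    by (auto intro: linear_mapI)
next
  case (Suc i)
  then show ?case
    using linear_map_compose[OF Suc b] by (simp add: algebra_simps)
qed

lemma submodule_N_cycles: "submodule (N_cycles C b i n) \<C> (C n)"
  unfolding N_cycles_def by (rule submodule_kernel[OF C C iterate_linear])

lemma submodule_N_boundaries: "submodule (N_boundaries N C b i n) \<C> (C n)"
  unfolding N_boundaries_def using iterate_linear[of "n + int (N - i)" "N - i"]
  by (intro submodule_image[OF C C]) simp

lemma module_N_homology: "module \<C> (N_homology N C b i n)"
  unfolding N_homology_def by (rule module_subquotient[OF C submodule_N_cycles submodule_N_boundaries])

lemma module_homology_object: "module \<C> (homology_object N C b n)"
  unfolding homology_object_def by (rule module_direct_sum[OF module_N_homology])

lemma module_total_homology: "module \<C> (total_homology N C b)"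
  unfolding total_homology_def by (rule module_direct_sum[OF module_homology_object])

lemma homology_class_linear:
  "linear_map ((C n)\<lparr>carrier := N_cycles C b i n\<rparr>) (N_homology N C b i n) (homology_class N C b i n)"
  unfolding N_homology_def homology_class_def[abs_def]
  by (rule coset_linear_map[OF C submodule_N_cycles submodule_N_boundaries])

lemma N_homology_inj_linear:
  assumes "i \<in> {1..N - 1}"
  shows "linear_map (N_homology N C b i (int n)) (total_homology N C b)
    (\<lambda>w. summand_inj UNIV (\<lambda>n. homology_object N C b (int n)) n
      (summand_inj {1..N - 1} (\<lambda>i. N_homology N C b i (int n)) i w))"
proof -
  have 1: "linear_map (N_homology N C b i (int n)) (homology_object N C b (int n))
      (summand_inj {1..N - 1} (\<lambda>i. N_homology N C b i (int n)) i)"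
    unfolding homology_object_def
    by (rule summand_inj_linear[of "{1..N - 1}" "\<lambda>i. N_homology N C b i (int n)",
          OF module_N_homology assms])
  have 2: "linear_map (homology_object N C b (int n)) (total_homology N C b)
      (summand_inj UNIV (\<lambda>n. homology_object N C b (int n)) n)"
    unfolding total_homology_def
    by (rule summand_inj_linear[of UNIV "\<lambda>n. homology_object N C b (int n)",
          OF module_homology_object UNIV_I])
  show ?thesis
    by (rule linear_map_compose[OF 1 2])
qed

lemma total_class_linear:
  assumes "i \<in> {1..N - 1}"
  shows "linear_map ((C (int n))\<lparr>carrier := N_cycles C b i (int n)\<rparr>) (total_homology N C b)
    (total_class N C b i n)"
  using linear_map_compose[OF homology_class_linear N_homology_inj_linear[OF assms]]
  by (simp add: total_class_def[abs_def])

lemma total_class_boundary: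
  assumes "i \<in> {1..N - 1}" "x \<in> N_boundaries N C b i (int n)"
  shows "total_class N C b i n x = \<zero>\<^bsub>total_homology N C b\<^esub>"
proof -
  have "x \<in> carrier (C (int n))"
    using module.submoduleE(1)[OF C submodule_N_boundaries] assms(2) by blast
  then have "homology_class N C b i (int n) x = \<zero>\<^bsub>N_homology N C b i (int n)\<^esub>"
    using coset_eq_zero_iff[OF C submodule_N_cycles submodule_N_boundaries] assms(2)
    by (simp add: homology_class_def N_homology_def quotient_space_def)
  then show ?thesis
    using linear_map_zero[OF module_N_homology module_total_homology N_homology_inj_linear[OF assms(1)]]
    by (simp add: total_class_def)
qed

text \<open>The total homology is spanned by the classes of cycles.\<close>

lemma total_homology_eqI:
  assumes M: "module \<C> M" and F: "linear_map (total_homology N C b) M F"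
    and G: "linear_map (total_homology N C b) M G"
    and eq: "\<And>n i x. i \<in> {1..N - 1} \<Longrightarrow> x \<in> N_cycles C b i (int n) \<Longrightarrow>
      F (total_class N C b i n x) = G (total_class N C b i n x)"
    and v: "v \<in> carrier (total_homology N C b)"
  shows "F v = G v"
proof (rule direct_sum_eqI[of UNIV "\<lambda>n. homology_object N C b (int n)", OF module_homology_object M])
  let ?inj = "summand_inj UNIV (\<lambda>n. homology_object N C b (int n))"
  fix n w assume w: "w \<in> carrier (homology_object N C b (int n))"
  have inj: "linear_map (direct_sum {1..N - 1} (\<lambda>i. N_homology N C b i (int n))) (total_homology N C b) (?inj n)"
    unfolding total_homology_def
    using summand_inj_linear[of UNIV "\<lambda>n. homology_object N C b (int n)", OF module_homology_object UNIV_I]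
    by (simp add: homology_object_def)
  show "F (?inj n w) = G (?inj n w)"
  proof (rule direct_sum_eqI[OF module_N_homology M linear_map_compose[OF inj F] linear_map_compose[OF inj G]])
    fix i c assume i: "i \<in> {1..N - 1}" and "c \<in> carrier (N_homology N C b i (int n))"
    then obtain x where x: "x \<in> N_cycles C b i (int n)" "c = homology_class N C b i (int n) x"
      using coset_surj[OF C submodule_N_cycles submodule_N_boundaries]
      unfolding N_homology_def homology_class_def by blast
    then show "F (?inj n (summand_inj {1..N - 1} (\<lambda>i. N_homology N C b i (int n)) i c)) =
        G (?inj n (summand_inj {1..N - 1} (\<lambda>i. N_homology N C b i (int n)) i c))"
      using eq[OF i x(1)] by (simp add: total_class_def)
  qed (use w in \<open>simp add: homology_object_def\<close>)
qed (use F G v in \<open>simp_all add: total_homology_def\<close>)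

text \<open>
  The universal properties of the two nested direct sums and of the quotient, combined.
\<close>

lemma total_homology_lift:
  assumes M: "module \<C> M"
    and f: "\<And>n i. i \<in> {1..N - 1} \<Longrightarrow> linear_map ((C (int n))\<lparr>carrier := N_cycles C b i (int n)\<rparr>) M (f n i)"
    and zero: "\<And>n i x. i \<in> {1..N - 1} \<Longrightarrow> x \<in> N_cycles C b i (int n) \<Longrightarrow>
      x \<in> N_boundaries N C b i (int n) \<Longrightarrow> f n i x = \<zero>\<^bsub>M\<^esub>"
  shows "\<exists>F\<in>Lin (total_homology N C b) M. \<forall>n. \<forall>i\<in>{1..N - 1}. \<forall>x\<in>N_cycles C b i (int n).
    F (total_class N C b i n x) = f n i x"
proof -
  have "\<exists>g\<in>Lin (N_homology N C b i (int n)) M. \<forall>x\<in>N_cycles C b i (int n).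
      g (homology_class N C b i (int n) x) = f n i x" if "i \<in> {1..N - 1}" for i n
    unfolding N_homology_def homology_class_def
    by (rule subquotient_factor[OF C submodule_N_cycles submodule_N_boundaries M f[OF that] zero[OF that]])
  then obtain g where g: "\<And>i n. i \<in> {1..N - 1} \<Longrightarrow> linear_map (N_homology N C b i (int n)) M (g i n)"
    "\<And>i n x. i \<in> {1..N - 1} \<Longrightarrow> x \<in> N_cycles C b i (int n) \<Longrightarrow>
      g i n (homology_class N C b i (int n) x) = f n i x"
    using Lin_linear by metis
  have "\<exists>h\<in>Lin (homology_object N C b (int n)) M. \<forall>i\<in>{1..N - 1}. \<forall>c\<in>carrier (N_homology N C b i (int n)).
      h (summand_inj {1..N - 1} (\<lambda>i. N_homology N C b i (int n)) i c) = g i n c" for n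
    unfolding homology_object_def by (rule direct_sum_lift[OF module_N_homology M g(1)])
  then obtain h where h: "\<And>n. linear_map (homology_object N C b (int n)) M (h n)"
    "\<And>n i c. i \<in> {1..N - 1} \<Longrightarrow> c \<in> carrier (N_homology N C b i (int n)) \<Longrightarrow>
      h n (summand_inj {1..N - 1} (\<lambda>i. N_homology N C b i (int n)) i c) = g i n c"
    using Lin_linear by metis
  obtain F where F: "F \<in> Lin (total_homology N C b) M"
    "\<And>n w. w \<in> carrier (homology_object N C b (int n)) \<Longrightarrow>
      F (summand_inj UNIV (\<lambda>n. homology_object N C b (int n)) n w) = h n w"
    using direct_sum_lift[of UNIV "\<lambda>n. homology_object N C b (int n)" M h, OF module_homology_object M h(1)]
    unfolding total_homology_def by blast
  have "F (total_class N C b i n x) = f n i x" if i: "i \<in> {1..N - 1}" and x: "x \<in> N_cycles C b i (int n)" for n i x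
  proof -
    have c: "homology_class N C b i (int n) x \<in> carrier (N_homology N C b i (int n))"
      by (rule linear_map_closed[OF homology_class_linear]) (simp add: x)
    have "summand_inj {1..N - 1} (\<lambda>i. N_homology N C b i (int n)) i (homology_class N C b i (int n) x)
        \<in> carrier (homology_object N C b (int n))"
      unfolding homology_object_def
      by (rule linear_map_closed[OF summand_inj_linear[of "{1..N - 1}" "\<lambda>i. N_homology N C b i (int n)",
            OF module_N_homology i] c])
    then show ?thesis
      by (simp only: total_class_def F(2) h(2)[OF i c] g(2)[OF i x])
  qed
  with F(1) show ?thesis by blast
qed

text \<open>A degree-preserving family of linear maps that commutes with \<open>b\<close> acts on the homology.\<close>

lemma
  assumes f: "\<And>n. linear_map (C n) (C n) (f n)"
    and comm: "\<And>n x. x \<in> carrier (C n) \<Longrightarrow> b n (f n x) = f (n - 1) (b n x)"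
  shows chain_map_cycles: "\<And>i n. f n ` N_cycles C b i n \<subseteq> N_cycles C b i n" (is "\<And>i n. ?Z i n")
    and chain_map_boundaries: "\<And>i n. f n ` N_boundaries N C b i n \<subseteq> N_boundaries N C b i n" (is "\<And>i n. ?B i n")
    and chain_map_homology: "\<exists>!F. F \<in> Lin (total_homology N C b) (total_homology N C b) \<and>
      (\<forall>n. \<forall>i\<in>{1..N - 1}. \<forall>x\<in>N_cycles C b i (int n).
        F (total_class N C b i n x) = total_class N C b i n (f (int n) x))" (is "\<exists>!F. ?P F")
proof -
  have it: "iterate b i n (f n x) = f (n - int i) (iterate b i n x)" if "x \<in> carrier (C n)" for i n x
  proof (induction i)
    case (Suc i)
    have "n - int i - 1 = n - int (Suc i)" by simp
    then show ?case
      using comm[OF linear_map_closed[OF iterate_linear that], of i] Suc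
      by (simp only: iterate.simps)
  qed simp
  show Z: "?Z i n" for i n
    by (auto simp: N_cycles_def it linear_map_zero[OF C C f] linear_map_closed[OF f])
  show B: "?B i n" for i n
  proof
    fix y assume "y \<in> f n ` N_boundaries N C b i n"
    then obtain x where x: "x \<in> carrier (C (n + int (N - i)))"
      "y = f n (iterate b (N - i) (n + int (N - i)) x)"
      by (auto simp: N_boundaries_def)
    then have "y = iterate b (N - i) (n + int (N - i)) (f (n + int (N - i)) x)"
      by (simp add: it)
    then show "y \<in> N_boundaries N C b i n"
      using linear_map_closed[OF f x(1)] by (auto simp: N_boundaries_def)
  qed
  show "\<exists>!F. ?P F"
  proof (rule ex_ex1I)
    have "\<exists>F\<in>Lin (total_homology N C b) (total_homology N C b).
        \<forall>n. \<forall>i\<in>{1..N - 1}. \<forall>x\<in>N_cycles C b i (int n).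
          F (total_class N C b i n x) = total_class N C b i n (f (int n) x)"
    proof (rule total_homology_lift[OF module_total_homology])
      fix n i assume i: "i \<in> {1..N - 1}"
      have "linear_map ((C (int n))\<lparr>carrier := N_cycles C b i (int n)\<rparr>)
          ((C (int n))\<lparr>carrier := N_cycles C b i (int n)\<rparr>) (f (int n))"
        using Z f[of "int n"] module.submoduleE(1)[OF C submodule_N_cycles]
        by (auto simp: linear_map_def subset_iff)
      then show "linear_map ((C (int n))\<lparr>carrier := N_cycles C b i (int n)\<rparr>) (total_homology N C b)
          (\<lambda>x. total_class N C b i n (f (int n) x))"
        by (rule linear_map_compose[OF _ total_class_linear[OF i]])
      fix x assume "x \<in> N_boundaries N C b i (int n)"
      then have "f (int n) x \<in> N_boundaries N C b i (int n)"
        using B by blast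
      then show "total_class N C b i n (f (int n) x) = \<zero>\<^bsub>total_homology N C b\<^esub>"
        by (rule total_class_boundary[OF i])
    qed
    then show "\<exists>F. ?P F" by blast
    fix F G assume P: "?P F" "?P G"
    have "F v = G v" if "v \<in> carrier (total_homology N C b)" for v
      using P by (intro total_homology_eqI[OF module_total_homology Lin_linear[OF conjunct1[OF P(1)]]
            Lin_linear[OF conjunct1[OF P(2)]] _ that]) simp
    then show "F = G"
      by (rule Lin_eqI[OF conjunct1[OF P(1)] conjunct1[OF P(2)]])
  qed
qed

end


section \<open>The Loday complex of a pointed simplicial set\<close>

text \<open>
  The operator in every integral degree. In the negative degrees, where the complex is zero,
  it is the identity.
\<close>

definition L_complex ::
  "(complex, 'a) module \<Rightarrow> (nat \<Rightarrow> 'y set \<times> 'y) \<Rightarrow> (nat \<Rightarrow> 'a \<Rightarrow> 'a) \<Rightarrow> nat \<Rightarrow> int \<Rightarrow>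
   ('a, 'y) Loday_elem \<Rightarrow> ('a, 'y) Loday_elem"
  where "L_complex A Y D k n = (if n < 0 then (\<lambda>x. x) else L_map A D k (Y (nat n)))"

lemma module_zero_space: "module \<C> zero_space"
  by (rule module_complexI) (auto simp: zero_space_def)

lemma coface_simplex_map: "1 \<le> n \<Longrightarrow> coface n i \<in> simplex_maps (n - 1) n"
  by (auto simp: simplex_maps_def coface_def mono_on_def)

context
  fixes A :: "(complex, 'a) module" and Y :: "nat \<Rightarrow> 'y set \<times> 'y"
    and Y_map :: "nat \<Rightarrow> nat \<Rightarrow> (nat \<Rightarrow> nat) \<Rightarrow> 'y \<Rightarrow> 'y" and q :: complex
  assumes algebra: "algebra \<C> A" and Y: "pointed_simplicial_finite_set Y Y_map"
begin

lemma module_Loday_complex: "module \<C> (Loday_complex A Y n)"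
  using module_Loday[OF algebra, of "Y (nat n)"] by (simp add: Loday_complex_def module_zero_space)

lemma face_pointed_map: "1 \<le> n \<Longrightarrow> Y_map (n - 1) n (coface n i) \<in> pointed_maps (Y n) (Y (n - 1))"
  by (rule pointed_simplicial_finite_set.Y_map_closed[OF Y coface_simplex_map])

lemma face_map_linear:
  assumes "0 < n"
  shows "linear_map (Loday_complex A Y n) (Loday_complex A Y (n - 1)) (face_map A Y Y_map (nat n) i)"
proof -
  have "nat (n - 1) = nat n - 1" "1 \<le> nat n"
    using assms by auto
  then show ?thesis
    using assms Loday_map_linear[OF algebra face_pointed_map] by (simp add: Loday_complex_def face_map_def)
qed

lemma q_boundary_linear:
  "linear_map (Loday_complex A Y n) (Loday_complex A Y (n - 1)) (q_boundary q A Y Y_map n)"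
proof (rule linear_map_cong[OF module_Loday_complex])
  show "linear_map (Loday_complex A Y n) (Loday_complex A Y (n - 1)) (\<lambda>x.
    if n \<le> 0 then \<zero>\<^bsub>Loday_complex A Y (n - 1)\<^esub>
    else \<Oplus>\<^bsub>Loday_complex A Y (n - 1)\<^esub>i\<in>{0..nat n}.
      (q ^ i) \<odot>\<^bsub>Loday_complex A Y (n - 1)\<^esub> face_map A Y Y_map (nat n) i x)"
    by (cases "n \<le> 0")
      (auto intro!: linear_map_const_zero linear_map_sum linear_map_smult_right module_Loday_complex
        face_map_linear)
qed (simp add: q_boundary_def)

context
  fixes D :: "nat \<Rightarrow> 'a \<Rightarrow> 'a" and k :: nat
  assumes derivation: "higher_derivation A D" and normalized: "normalized_derivation A D"
begin

lemma L_complex_linear: "linear_map (Loday_complex A Y n) (Loday_complex A Y n) (L_complex A Y D k n)"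
  using L_map_linear[OF algebra derivation normalized, of "Y (nat n)"]
  by (auto simp: Loday_complex_def L_complex_def intro: linear_mapI)

lemma L_complex_face_map:
  assumes "0 < n" "x \<in> carrier (Loday_complex A Y n)"
  shows "face_map A Y Y_map (nat n) i (L_complex A Y D k n x) =
    L_complex A Y D k (n - 1) (face_map A Y Y_map (nat n) i x)"
proof -
  have "nat (n - 1) = nat n - 1" "1 \<le> nat n"
    using assms by auto
  then show ?thesis
    using assms L_map_natural[OF algebra derivation normalized face_pointed_map]
    by (simp add: Loday_complex_def face_map_def L_complex_def)
qed

lemma L_complex_q_boundary:
  assumes x: "x \<in> carrier (Loday_complex A Y n)"
  shows "q_boundary q A Y Y_map n (L_complex A Y D k n x) =
    L_complex A Y D k (n - 1) (q_boundary q A Y Y_map n x)"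
proof (cases "n \<le> 0")
  case True
  then show ?thesis
    using x linear_map_closed[OF L_complex_linear x]
      linear_map_zero[OF module_Loday_complex module_Loday_complex L_complex_linear]
    by (simp add: q_boundary_def)
next
  case False
  let ?C = "Loday_complex A Y (n - 1)" and ?d = "face_map A Y Y_map (nat n)"
  interpret C: module \<C> ?C by (rule module_Loday_complex)
  have d: "?d i x \<in> carrier ?C" for i
    using linear_map_closed[OF face_map_linear x] False by simp
  have "L_complex A Y D k (n - 1) (q_boundary q A Y Y_map n x) =
      L_complex A Y D k (n - 1) (\<Oplus>\<^bsub>?C\<^esub>i\<in>{0..nat n}. (q ^ i) \<odot>\<^bsub>?C\<^esub> ?d i x)"
    using False x by (simp add: q_boundary_def)
  also have "\<dots> = (\<Oplus>\<^bsub>?C\<^esub>i\<in>{0..nat n}. L_complex A Y D k (n - 1) ((q ^ i) \<odot>\<^bsub>?C\<^esub> ?d i x))"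
    by (rule linear_map_finsum[OF module_Loday_complex module_Loday_complex L_complex_linear])
      (auto intro!: C.smult_closed d)
  also have "\<dots> = (\<Oplus>\<^bsub>?C\<^esub>i\<in>{0..nat n}. (q ^ i) \<odot>\<^bsub>?C\<^esub> ?d i (L_complex A Y D k n x))"
    using False x by (simp add: linear_map_smult[OF L_complex_linear d] L_complex_face_map)
  also have "\<dots> = q_boundary q A Y Y_map n (L_complex A Y D k n x)"
    using False linear_map_closed[OF L_complex_linear x] by (simp add: q_boundary_def)
  finally show ?thesis ..
qed

end

end

section \<open>The induced map on the homology\<close>

theorem theorem1p2:
  fixes A :: "(complex, 'a) module"
    and Y :: "nat \<Rightarrow> 'y set \<times> 'y"
    and Y_map :: "nat \<Rightarrow> nat \<Rightarrow> (nat \<Rightarrow> nat) \<Rightarrow> 'y \<Rightarrow> 'y"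
    and N :: nat and q :: complex
    and D :: "nat \<Rightarrow> 'a \<Rightarrow> 'a" and k :: nat
  defines "C \<equiv> Loday_complex A Y"
    and "b \<equiv> q_boundary q A Y Y_map"
    and "HH \<equiv> q_Hochschild N q A Y Y_map"
  assumes "algebra \<C> A"
    and "pointed_simplicial_finite_set Y Y_map"
    and "N \<ge> 2" and "primitive_root_of_unity N q"
    and "higher_derivation A D" and "normalized_derivation A D"
  shows
    "(\<forall>n. \<forall>i\<in>{1..N - 1}.
        L_map A D k (Y n) ` N_cycles C b i (int n) \<subseteq> N_cycles C b i (int n) \<and>
        L_map A D k (Y n) ` N_boundaries N C b i (int n) \<subseteq> N_boundaries N C b i (int n)) \<and>
     (\<exists>!F. F \<in> Lin HH HH \<and>
        (\<forall>n. \<forall>i\<in>{1..N - 1}. \<forall>x\<in>N_cycles C b i (int n).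
          F (total_class N C b i n x) = total_class N C b i n (L_map A D k (Y n) x)))"
proof -
  note alg = \<open>algebra \<C> A\<close> and Y = \<open>pointed_simplicial_finite_set Y Y_map\<close>
    and D = \<open>higher_derivation A D\<close> \<open>normalized_derivation A D\<close>
  have C: "module \<C> (C n)" for n
    unfolding C_def by (rule module_Loday_complex[OF alg Y])
  have b: "linear_map (C n) (C (n - 1)) (b n)" for n
    unfolding C_def b_def by (rule q_boundary_linear[OF alg Y])
  have L: "linear_map (C n) (C n) (L_complex A Y D k n)" for n
    unfolding C_def by (rule L_complex_linear[OF alg Y D])
  have comm: "b n (L_complex A Y D k n x) = L_complex A Y D k (n - 1) (b n x)"
    if "x \<in> carrier (C n)" for n x
    using that unfolding C_def b_def by (rule L_complex_q_boundary[OF alg Y D])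
  have Ln: "L_complex A Y D k (int n) = L_map A D k (Y n)" for n
    by (simp add: L_complex_def)
  have "L_map A D k (Y n) ` N_cycles C b i (int n) \<subseteq> N_cycles C b i (int n)"
    "L_map A D k (Y n) ` N_boundaries N C b i (int n) \<subseteq> N_boundaries N C b i (int n)" for n i
    using chain_map_cycles[where C = C and b = b and f = "L_complex A Y D k" and n = "int n" and i = i,
        OF C b L comm]
      chain_map_boundaries[where C = C and b = b and f = "L_complex A Y D k" and n = "int n" and i = i,
        OF C b L comm]
    by (simp_all only: Ln)
  moreover have "\<exists>!F. F \<in> Lin HH HH \<and>
      (\<forall>n. \<forall>i\<in>{1..N - 1}. \<forall>x\<in>N_cycles C b i (int n).
        F (total_class N C b i n x) = total_class N C b i n (L_map A D k (Y n) x))"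
    using chain_map_homology[where C = C and b = b and f = "L_complex A Y D k" and N = N, OF C b L comm]
    by (simp only: Ln HH_def q_Hochschild_def C_def[symmetric] b_def[symmetric])
  ultimately show ?thesis by blast
qed

end
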